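(* Let $T$ be a $\Delta(1,2,2)$-free tournament. Then one of the following holds: (1) $T$ is isomorphic to a basic tournament; (2) $T$ is a $\Delta(1,2,2)$-free paving tournament; (3) $T$ is obtained from a $\Delta(1,2,2)$-free tournament with fewer vertices by substituting a basic tournament for a nice vertex; or (4) $T$ is obtained from a $\Delta(1,2,2)$-free tournament with fewer vertices by applying a $P_7^-$-join to a bridge.
   Context: Tournaments are finite; $uv\in E(T)$ means the edge is directed from $u$ to $v$; $T$ is $S$-free if no induced subtournament is isomorphic to $S$. For disjoint nonempty $X,Y$, $X\Rightarrow Y$ means all edges between them go from $X$ to $Y$. $\Delta(1,2,2)$: vertices $x,y_1,y_2,z_1,z_2$ with $x\Rightarrow\{y_1,y_2\}\Rightarrow\{z_1,z_2\}\Rightarrow x$ and edges $y_1y_2,z_1z_2$. $T_5$: vertices $v_1,\dots,v_5$, $v_iv_j\in E$ iff $j-i\equiv1,2\pmod5$. $P_7$: vertices $v_1,\dots,v_7$, $v_iv_j\in E$ iff $j-i\equiv1,2,4\pmod 7$. $P_7^-$: $P_7$ minus one vertex. Basic tournaments: $T_5,P_7^-,P_7$. Degree partition of $P_7^-$: $(D_1,D_2)$ with $D_1$ the vertices of out-degree $3$, $D_2$ those of out-degree $2$. Ordering $\sigma=(v_1,\dots,v_n)$ of $V(T)$; backedge graph $B_\sigma(T)$: undirected graph on $V(T)$ with edges $v_iv_j$ for $i>j$ and $v_iv_j\in E(T)$. $T$ is a paving tournament if some ordering $\sigma=(v_1,\dots,v_n)$ (a paving ordering) satisfies: (P1) $v_i,v_{i+1}$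 are nonadjacent in $B_\sigma(T)$ for all $i\in[n-1]$; (P2) each $v_i$ has at most one $B_\sigma(T)$-neighbour in $\{v_s:s<i\}$ and at most one in $\{v_t:t>i\}$. A vertex $v$ is nice if there are no three distinct vertices $x,y_1,y_2$ such that both $\{v,x,y_1\}$ and $\{v,x,y_2\}$ induce cyclic triangles. An edge $uv\in E(T)$ of a tournament with $n$ vertices is a bridge if there is an ordering $\sigma=(v_1,\dots,v_n)$ with $u=v_i$, $v=v_j$, $i>j$, such that $uv$ is an isolated edge of $B_\sigma(T)$ (both ends have degree $1$), the edges of $B_\sigma(T)$ between $\{v_s:s<i\}$ and $\{v_t:t>i\}$ form a matching, and the edges of $B_\sigma(T)$ between $\{v_s:s<j\}$ and $\{v_t:t>j\}$ form a matching. Substituting a tournament $S_2$ for a vertex $v$ of $S_1$: replace $v$ by a copy of $S_2$, keep all other edges, and for $x_1\in V(S_1)\setminus\{v\}$, $x_2\in V(S_2)$ direct the edge from $x_1$ to $x_2$ iff $x_1v\in E(S_1)$. $P_7^-$-join: given a tournament $J$ and edge $uv\in E(J)$, take a copy $S$ of $P_7^-$ with degree partition $(D_1,D_2)$; the resulting tournament $T$ has vertex set $(V(J)\setminus\{u,v\})\cup V(S)$ (disjoint), $T[V(S)]=S$, $T[V(J)\setminus\{u,v\}]=J\setminus\{u,v\}$, and for each $w\in V(J)\setminus\{u,v\}$, every edge between $w$ and $D_2$ is directed as the edge between $w$ and $u$ in $J$, and every edge between $w$ and $D_1$ is directed as the edge between $w$ and $v$ in $J$. *)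

theory Defs
  imports "Graph_Theory.Graph_Theory"
begin

locale tournament = pair_digraph +
  assumes one_direction:
    "\<lbrakk>u \<in> pverts G; v \<in> pverts G; u \<noteq> v\<rbrakk> \<Longrightarrow> (u, v) \<in> parcs G \<longleftrightarrow> (v, u) \<notin> parcs G"

definition contains_copy :: "'a pair_pre_digraph \<Rightarrow> 'b pair_pre_digraph \<Rightarrow> bool" where
  "contains_copy T S \<longleftrightarrow> (\<exists>X \<subseteq> pverts T. digraph_iso (with_proj T \<restriction> X) S)"

abbreviation free_of :: "'a pair_pre_digraph \<Rightarrow> 'b pair_pre_digraph \<Rightarrow> bool" where
  "free_of T S \<equiv> \<not> contains_copy T S"


text \<open>The vertices $x, y_1, y_2, z_1, z_2$ are the integers $1, 2, 3, 4, 5$.\<close>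

definition Delta122 :: "int pair_pre_digraph" where
  "Delta122 = \<lparr> pverts = {1..5},
     parcs = {1} \<times> {2, 3} \<union> {2, 3} \<times> {4, 5} \<union> {4, 5} \<times> {1} \<union> {(2, 3), (4, 5)} \<rparr>"

definition T5 :: "int pair_pre_digraph" where
  "T5 = \<lparr> pverts = {1..5},
     parcs = {(i, j). i \<in> {1..5} \<and> j \<in> {1..5} \<and> (j - i) mod 5 \<in> {1, 2}} \<rparr>"

definition P7 :: "int pair_pre_digraph" where
  "P7 = \<lparr> pverts = {1..7},
     parcs = {(i, j). i \<in> {1..7} \<and> j \<in> {1..7} \<and> (j - i) mod 7 \<in> {1, 2, 4}} \<rparr>"

text \<open>
  Rotations are automorphisms of \<open>P7\<close>, so it is immaterial, up to isomorphism, which vertex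
  is deleted.
\<close>

definition P7_minus :: "int pair_pre_digraph" where
  "P7_minus = \<lparr> pverts = pverts P7 - {7}, parcs = {(i, j) \<in> parcs P7. i \<noteq> 7 \<and> j \<noteq> 7} \<rparr>"

definition D1 :: "int set" where
  "D1 = {w \<in> pverts P7_minus. out_degree P7_minus w = 3}"

definition D2 :: "int set" where
  "D2 = {w \<in> pverts P7_minus. out_degree P7_minus w = 2}"

definition basic :: "'a pair_pre_digraph \<Rightarrow> bool" where
  "basic S \<longleftrightarrow> digraph_iso S T5 \<or> digraph_iso S P7_minus \<or> digraph_iso S P7"


text \<open>
  An ordering of the vertex set is a repetition-free list, with positions counted from \<open>0\<close>.
  The undirected graph $B_\sigma(T)$ is rendered, as usual in this library, by a symmetric
  digraph, so that the degree of a vertex is its \<^const>\<open>out_degree\<close>.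
\<close>

definition vertex_ordering :: "'a pair_pre_digraph \<Rightarrow> 'a list \<Rightarrow> bool" where
  "vertex_ordering T \<sigma> \<longleftrightarrow> distinct \<sigma> \<and> set \<sigma> = pverts T"

definition backedges :: "'a pair_pre_digraph \<Rightarrow> 'a list \<Rightarrow> 'a rel" where
  "backedges T \<sigma> = {(\<sigma> ! i, \<sigma> ! j) | i j. j < i \<and> i < length \<sigma> \<and> (\<sigma> ! i, \<sigma> ! j) \<in> parcs T}"

definition backedge_graph :: "'a pair_pre_digraph \<Rightarrow> 'a list \<Rightarrow> 'a pair_pre_digraph" where
  "backedge_graph T \<sigma> = \<lparr> pverts = pverts T, parcs = backedges T \<sigma> \<union> (backedges T \<sigma>)\<inverse> \<rparr>"

definition paving_ordering :: "'a pair_pre_digraph \<Rightarrow> 'a list \<Rightarrow> bool" where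
  "paving_ordering T \<sigma> \<longleftrightarrow> vertex_ordering T \<sigma> \<and>
     (\<forall>i. Suc i < length \<sigma> \<longrightarrow> (\<sigma> ! i, \<sigma> ! Suc i) \<notin> parcs (backedge_graph T \<sigma>)) \<and>
     (\<forall>i < length \<sigma>.
        card {s. s < i \<and> (\<sigma> ! i, \<sigma> ! s) \<in> parcs (backedge_graph T \<sigma>)} \<le> 1 \<and>
        card {t. i < t \<and> t < length \<sigma> \<and> (\<sigma> ! i, \<sigma> ! t) \<in> parcs (backedge_graph T \<sigma>)} \<le> 1)"

definition paving :: "'a pair_pre_digraph \<Rightarrow> bool" where
  "paving T \<longleftrightarrow> (\<exists>\<sigma>. paving_ordering T \<sigma>)"


definition cyclic_triangle :: "'a pair_pre_digraph \<Rightarrow> 'a \<Rightarrow> 'a \<Rightarrow> 'a \<Rightarrow> bool" where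
  "cyclic_triangle T a b c \<longleftrightarrow>
     (a, b) \<in> parcs T \<and> (b, c) \<in> parcs T \<and> (c, a) \<in> parcs T \<or>
     (a, c) \<in> parcs T \<and> (c, b) \<in> parcs T \<and> (b, a) \<in> parcs T"

definition nice_vertex :: "'a pair_pre_digraph \<Rightarrow> 'a \<Rightarrow> bool" where
  "nice_vertex T v \<longleftrightarrow> v \<in> pverts T \<and>
     \<not> (\<exists>x y1 y2. x \<noteq> y1 \<and> x \<noteq> y2 \<and> y1 \<noteq> y2 \<and>
          cyclic_triangle T v x y1 \<and> cyclic_triangle T v x y2)"

definition matching_between :: "'a pair_pre_digraph \<Rightarrow> 'a set \<Rightarrow> 'a set \<Rightarrow> bool" where
  "matching_between B X Y \<longleftrightarrow> pairwise disjnt {{x, y} | x y. x \<in> X \<and> y \<in> Y \<and> (x, y) \<in> parcs B}"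

definition bridge :: "'a pair_pre_digraph \<Rightarrow> 'a \<Rightarrow> 'a \<Rightarrow> bool" where
  "bridge T u v \<longleftrightarrow> (u, v) \<in> parcs T \<and>
     (\<exists>\<sigma> i j. vertex_ordering T \<sigma> \<and> i < length \<sigma> \<and> j < i \<and> u = \<sigma> ! i \<and> v = \<sigma> ! j \<and>
        out_degree (backedge_graph T \<sigma>) u = 1 \<and> out_degree (backedge_graph T \<sigma>) v = 1 \<and>
        matching_between (backedge_graph T \<sigma>) (set (take i \<sigma>)) (set (drop (Suc i) \<sigma>)) \<and>
        matching_between (backedge_graph T \<sigma>) (set (take j \<sigma>)) (set (drop (Suc j) \<sigma>)))"


text \<open>
  The two constructions below produce a tournament on a sum type: \<open>Inl\<close> marks the vertices kept
  from the first tournament and \<open>Inr\<close> the vertices of the inserted copy.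
\<close>

definition substitute :: "'a pair_pre_digraph \<Rightarrow> 'a \<Rightarrow> 'b pair_pre_digraph \<Rightarrow> ('a + 'b) pair_pre_digraph"
  where
  "substitute S1 v S2 = (let W = pverts S1 - {v} in
     \<lparr> pverts = Inl ` W \<union> Inr ` pverts S2,
       parcs =
         {(Inl x, Inl y) | x y. x \<in> W \<and> y \<in> W \<and> (x, y) \<in> parcs S1} \<union>
         {(Inr x, Inr y) | x y. (x, y) \<in> parcs S2} \<union>
         {(Inl x, Inr y) | x y. x \<in> W \<and> y \<in> pverts S2 \<and> (x, v) \<in> parcs S1} \<union>
         {(Inr y, Inl x) | x y. x \<in> W \<and> y \<in> pverts S2 \<and> (x, v) \<notin> parcs S1} \<rparr>)"

definition P7_minus_join :: "'a pair_pre_digraph \<Rightarrow> 'a \<Rightarrow> 'a \<Rightarrow> ('a + int) pair_pre_digraph" where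
  "P7_minus_join J u v = (let W = pverts J - {u, v} in
     \<lparr> pverts = Inl ` W \<union> Inr ` pverts P7_minus,
       parcs =
         {(Inl x, Inl y) | x y. x \<in> W \<and> y \<in> W \<and> (x, y) \<in> parcs J} \<union>
         {(Inr x, Inr y) | x y. (x, y) \<in> parcs P7_minus} \<union>
         {(Inl w, Inr d) | w d. w \<in> W \<and> d \<in> D2 \<and> (w, u) \<in> parcs J} \<union>
         {(Inr d, Inl w) | w d. w \<in> W \<and> d \<in> D2 \<and> (u, w) \<in> parcs J} \<union>
         {(Inl w, Inr d) | w d. w \<in> W \<and> d \<in> D1 \<and> (w, v) \<in> parcs J} \<union>
         {(Inr d, Inl w) | w d. w \<in> W \<and> d \<in> D1 \<and> (v, w) \<in> parcs J} \<rparr>)"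

end

theory Submission
  imports Defs
begin

text \<open>
  An outside vertex of a copy of \<open>T5\<close> or \<open>P7\<close> in a $\Delta(1,2,2)$-free tournament is homogeneous to
  the copy, so the copy arises by substitution, and freeness makes the substituted vertex nice.
  An outside vertex of a copy of \<open>P7_minus\<close> is homogeneous to it, or completes it to \<open>P7\<close>, or is
  dominated by \<open>D1\<close> and dominates \<open>D2\<close>; without \<open>P7\<close> this yields a join, the ordering for the bridge
  listing the outside vertices by these three kinds.

  If \<open>T5\<close> and \<open>P7_minus\<close> are absent too, a paving ordering is built by induction. Assuming that all
  vertex-deleted subtournaments are paving, some vertex has in-degree or out-degree at most one,
  because otherwise the end of a paving ordering after deleting a vertex of in-degree two exhibits
  a forbidden subtournament. Such a vertex can be inserted at an end of an ordering after a local
  rotation. Condition (P1) comes for free, by taking the fewest back edges subject to (P2).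
\<close>

section \<open>Orderings with few back edges\<close>

text \<open>\<open>delta\<close> leaves the arcs inside the two pairs open: in a tournament,
  whichever way they point, renaming within the pairs gives a copy of Delta(1,2,2). Vertices of
  different classes are distinct because of the arcs between them.\<close>

locale delta_free_tour =
  fixes V :: "'a set" and E :: "'a \<Rightarrow> 'a \<Rightarrow> bool"
  assumes fin: "finite V"
    and irrefl: "x \<in> V \<Longrightarrow> \<not> E x x"
    and total: "x \<in> V \<Longrightarrow> y \<in> V \<Longrightarrow> x \<noteq> y \<Longrightarrow> E x y \<longleftrightarrow> \<not> E y x"
    and delta: "\<lbrakk>x \<in> V; y1 \<in> V; y2 \<in> V; z1 \<in> V; z2 \<in> V; y1 \<noteq> y2; z1 \<noteq> z2;
      E x y1; E x y2; E y1 z1; E y1 z2; E y2 z1; E y2 z2; E z1 x; E z2 x\<rbrakk> \<Longrightarrow> False"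
begin

lemma asym: "x \<in> V \<Longrightarrow> y \<in> V \<Longrightarrow> E x y \<Longrightarrow> \<not> E y x"
  using irrefl total by metis

lemma subset:
  assumes "U \<subseteq> V"
  shows "delta_free_tour U E"
proof
  show "finite U" using fin assms finite_subset by blast
  show "\<not> E x x" if "x \<in> U" for x using irrefl that assms by blast
  show "E x y \<longleftrightarrow> \<not> E y x" if "x \<in> U" "y \<in> U" "x \<noteq> y" for x y
    using total[of x y] that assms by blast
  fix x y1 y2 z1 z2
  assume *: "x \<in> U" "y1 \<in> U" "y2 \<in> U" "z1 \<in> U" "z2 \<in> U" "y1 \<noteq> y2" "z1 \<noteq> z2"
    "E x y1" "E x y2" "E y1 z1" "E y1 z2" "E y2 z1" "E y2 z2" "E z1 x" "E z2 x"
  show False by (rule delta[of x y1 y2 z1 z2]) (use * assms in auto)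
qed

text \<open>Delta(1,2,2) is isomorphic to its own reverse, by exchanging the two pairs. This lets
  results on in-degree be applied to out-degree.\<close>

lemma converse: "delta_free_tour V (\<lambda>x y. E y x)"
proof
  show "E y x \<longleftrightarrow> \<not> E x y" if "x \<in> V" "y \<in> V" "x \<noteq> y" for x y
    using total[of x y] that by blast
  fix x y1 y2 z1 z2
  assume *: "x \<in> V" "y1 \<in> V" "y2 \<in> V" "z1 \<in> V" "z2 \<in> V" "y1 \<noteq> y2" "z1 \<noteq> z2"
    "E y1 x" "E y2 x" "E z1 y1" "E z2 y1" "E z1 y2" "E z2 y2" "E x z1" "E x z2"
  show False by (rule delta[of x z1 z2 y1 y2]) (use * in auto)
qed (use fin irrefl in auto)

end

text \<open>Orderings are given by integer positions instead of lists: moving a vertex is a function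
  update, doubling the positions opens gaps, and negation reverses the order. Each edge of the
  backedge graph occurs once, with its earlier end first.\<close>

definition backs :: "'a set \<Rightarrow> ('a \<Rightarrow> 'a \<Rightarrow> bool) \<Rightarrow> ('a \<Rightarrow> int) \<Rightarrow> 'a rel" where
  "backs V E pos = {(a, b). a \<in> V \<and> b \<in> V \<and> pos a < pos b \<and> E b a}"

text \<open>Single-valuedness of the relation and of its converse is condition (P2).\<close>

definition single_back :: "'a set \<Rightarrow> ('a \<Rightarrow> 'a \<Rightarrow> bool) \<Rightarrow> ('a \<Rightarrow> int) \<Rightarrow> bool" where
  "single_back V E pos \<longleftrightarrow> inj_on pos V \<and>
     single_valued (backs V E pos) \<and> single_valued ((backs V E pos)\<inverse>)"

text \<open>The second conjunct is condition (P1): the ends of a back edge are not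
  consecutive.\<close>

definition paved :: "'a set \<Rightarrow> ('a \<Rightarrow> 'a \<Rightarrow> bool) \<Rightarrow> ('a \<Rightarrow> int) \<Rightarrow> bool" where
  "paved V E pos \<longleftrightarrow> single_back V E pos \<and>
     (\<forall>(a, b) \<in> backs V E pos. \<exists>m \<in> V. pos a < pos m \<and> pos m < pos b)"

lemma single_backI:
  assumes "inj_on pos V"
    and "\<And>a b c. \<lbrakk>a \<in> V; b \<in> V; c \<in> V; pos a < pos c; pos b < pos c; E c a; E c b\<rbrakk> \<Longrightarrow> a = b"
    and "\<And>a b c. \<lbrakk>a \<in> V; b \<in> V; c \<in> V; pos c < pos a; pos c < pos b; E a c; E b c\<rbrakk> \<Longrightarrow> a = b"
  shows "single_back V E pos"
  using assms unfolding single_back_def backs_def single_valued_def by blast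

lemma single_backD:
  assumes "single_back V E pos"
  shows "\<And>a b. \<lbrakk>a \<in> V; b \<in> V; a \<noteq> b\<rbrakk> \<Longrightarrow> pos a \<noteq> pos b"
    and "\<And>a b c. \<lbrakk>a \<in> V; b \<in> V; c \<in> V; pos a < pos c; pos b < pos c; E c a; E c b\<rbrakk> \<Longrightarrow> a = b"
    and "\<And>a b c. \<lbrakk>a \<in> V; b \<in> V; c \<in> V; pos c < pos a; pos c < pos b; E a c; E b c\<rbrakk> \<Longrightarrow> a = b"
  using assms unfolding single_back_def backs_def single_valued_def inj_on_def by blast+

lemma pavedD:
  assumes "paved V E pos"
  shows "single_back V E pos"
    and "\<And>a b. \<lbrakk>a \<in> V; b \<in> V; pos a < pos b; E b a\<rbrakk> \<Longrightarrow> \<exists>m \<in> V. pos a < pos m \<and> pos m < pos b"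
  using assms unfolding paved_def backs_def by auto

text \<open>Swapping two consecutive vertices joined by a back edge removes that back edge and no other.\<close>

lemma ex_paved_of_single_back:
  assumes fin: "finite V" and asym: "\<And>x y. x \<in> V \<Longrightarrow> y \<in> V \<Longrightarrow> E x y \<Longrightarrow> \<not> E y x"
    and "single_back V E pos0"
  shows "\<exists>pos. paved V E pos"
proof -
  obtain pos where pos: "single_back V E pos"
    and least: "\<And>pos'. single_back V E pos' \<Longrightarrow> card (backs V E pos) \<le> card (backs V E pos')"
    using ex_has_least_nat[of "single_back V E" pos0 "\<lambda>p. card (backs V E p)"] assms(3) by blast
  have "\<exists>m \<in> V. pos a < pos m \<and> pos m < pos b"
    if ab: "a \<in> V" "b \<in> V" "pos a < pos b" "E b a" for a b
  proof (rule ccontr)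
    assume "\<not> ?thesis"
    then have gap: "pos m \<le> pos a \<or> pos b \<le> pos m" if "m \<in> V" for m
      using that by force
    have inj: "inj_on pos V" using pos by (simp add: single_back_def)
    define pos' where "pos' = pos(a := pos b, b := pos a)"
    \<comment> \<open>By \<open>gap\<close> nothing lies between \<open>a\<close> and
      \<open>b\<close>, so exchanging them alters the order of no other pair.\<close>
    have lt: "pos' x < pos' y \<longleftrightarrow> pos x < pos y"
      if "x \<in> V" "y \<in> V" "\<not> (x = a \<and> y = b)" "\<not> (x = b \<and> y = a)" for x y
      using gap[OF that(1)] gap[OF that(2)] that ab inj_onD[OF inj _ \<open>a \<in> V\<close>] inj_onD[OF inj _ \<open>b \<in> V\<close>]
      unfolding pos'_def by (smt (verit, best) fun_upd_apply)
    have "inj_on pos' V"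
      using lt ab inj unfolding inj_on_def
      by (metis fun_upd_apply pos'_def)
    have sub: "backs V E pos' \<subseteq> backs V E pos - {(a, b)}"
    proof
      fix e assume "e \<in> backs V E pos'"
      then obtain x y where e: "e = (x, y)" "x \<in> V" "y \<in> V" "pos' x < pos' y" "E y x"
        unfolding backs_def by blast
      have "\<not> (x = a \<and> y = b)" using e(4) ab(3) unfolding pos'_def by (auto split: if_splits)
      moreover have "\<not> (x = b \<and> y = a)" using e ab asym by blast
      ultimately show "e \<in> backs V E pos - {(a, b)}" using e lt unfolding backs_def by auto
    qed
    have "single_back V E pos'"
      using pos sub \<open>inj_on pos' V\<close> unfolding single_back_def
      by (metis Diff_subset converse_mono single_valued_subset subset_trans)
    have "finite (backs V E pos)"
      by (rule finite_subset[of _ "V \<times> V"]) (use fin in \<open>auto simp: backs_def\<close>)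
    moreover have "(a, b) \<in> backs V E pos" using ab by (simp add: backs_def)
    ultimately have "card (backs V E pos') < card (backs V E pos)"
      using sub by (intro psubset_card_mono) blast+
    then show False using least[OF \<open>single_back V E pos'\<close>] by simp
  qed
  then show ?thesis using pos unfolding paved_def backs_def by blast
qed

text \<open>Reversing the arcs together with the order turns the back edges into the converse
  relation, and both conditions are symmetric under this.\<close>

lemma paved_converse:
  assumes "paved V E pos"
  shows "paved V (\<lambda>x y. E y x) (\<lambda>x. - pos x)"
proof -
  have "backs V (\<lambda>x y. E y x) (\<lambda>x. - pos x) = (backs V E pos)\<inverse>"
    unfolding backs_def by auto
  then show ?thesis
    using assms unfolding paved_def single_back_def by (auto simp: inj_on_def)
qed

section \<open>Inserting a vertex of in-degree at most one\<close>

context delta_free_tour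
begin

text \<open>
  Put \<open>v\<close> in front. This fails only if its in-neighbour \<open>w\<close> already has a back edge, to some \<open>u\<close>;
  then a single vertex \<open>y\<close> lies between \<open>u\<close> and \<open>w\<close>, with \<open>u \<rightarrow> y \<rightarrow> w \<rightarrow> u\<close>, and it suffices to
  rotate this triple.
\<close>

lemma ex_paved_insert:
  assumes v: "v \<in> V" and paved: "paved (V - {v}) E pos"
    and in1: "\<And>p q. \<lbrakk>p \<in> V; q \<in> V; E p v; E q v\<rbrakk> \<Longrightarrow> p = q"
  shows "\<exists>pos'. paved V E pos'"
proof -
  let ?W = "V - {v}"
  note inj = single_backD(1)[OF pavedD(1)[OF paved]]
  note left = single_backD(2)[OF pavedD(1)[OF paved]]
  note right = single_backD(3)[OF pavedD(1)[OF paved]]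
  note sep = pavedD(2)[OF paved]
  obtain c where c: "\<And>m. m \<in> V \<Longrightarrow> c < pos m"
  proof
    show "Min (pos ` V) - 1 < pos m" if "m \<in> V" for m
      using that fin by (simp add: less_le_trans Min_le diff_less_eq)
  qed
  have suff: ?thesis if "single_back V E pos'" for pos'
    using ex_paved_of_single_back[OF fin asym that] by blast
  consider (front) "\<And>w u. \<lbrakk>w \<in> ?W; u \<in> ?W; E w v; pos u < pos w\<rbrakk> \<Longrightarrow> \<not> E w u"
    | (bad) w u where "w \<in> ?W" "u \<in> ?W" "E w v" "pos u < pos w" "E w u" by blast
  then show ?thesis
  proof cases
    case front
    have "single_back V E (pos(v := c))"
    proof (rule single_backI)
      show "inj_on (pos(v := c)) V"
        using inj c unfolding inj_on_def by (metis DiffI fun_upd_apply less_irrefl singletonD)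
    next
      fix a b x assume *: "a \<in> V" "b \<in> V" "x \<in> V" "(pos(v := c)) a < (pos(v := c)) x"
        "(pos(v := c)) b < (pos(v := c)) x" "E x a" "E x b"
      show "a = b"
      proof (cases "x = v")
        case True
        then show ?thesis using * c[OF \<open>a \<in> V\<close>] by (auto split: if_splits)
      next
        case False
        then show ?thesis using * left[of a b x] front[of x a] front[of x b]
          by (auto split: if_splits)
      qed
    next
      fix a b x assume *: "a \<in> V" "b \<in> V" "x \<in> V" "(pos(v := c)) x < (pos(v := c)) a"
        "(pos(v := c)) x < (pos(v := c)) b" "E a x" "E b x"
      show "a = b"
        using * right[of a b x] in1[of a b] c[OF \<open>x \<in> V\<close>] by (auto split: if_splits)
    qed
    then show ?thesis by (rule suff)
  next
    case bad
    note wu = bad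
    have wuV: "w \<in> V" "u \<in> V" "w \<noteq> v" "u \<noteq> v" "w \<noteq> u" using wu by auto
    have v_out: "E v m" if "m \<in> V" "m \<noteq> v" "m \<noteq> w" for m
      using in1[of m w] total[of v m] that wu v by auto
    have to_w: "E m w" if "m \<in> ?W" "pos m < pos w" "m \<noteq> u" for m
      using left[of m u w] total[of m w] that wu by auto
    have u_out: "E u m" if "m \<in> ?W" "pos u < pos m" "m \<noteq> w" for m
      using right[of m w u] total[of m u] that wu by auto
    obtain y where y: "y \<in> ?W" "pos u < pos y" "pos y < pos w"
      using sep[of u w] wu by blast
    have yV: "y \<in> V" "y \<noteq> v" "y \<noteq> u" "y \<noteq> w" using y wu by auto
    have "E u y" using u_out y yV by blast
    have "E y w" using to_w y yV by blast
    \<comment> \<open>Otherwise \<open>w -> {v, u} -> {m, y} -> w\<close> is a forbidden copy. The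
      same copy arises in \<open>no_right\<close> from an arc back to \<open>w\<close>.\<close>
    have to_u: "E m u" if "m \<in> ?W" "pos m < pos w" "m \<noteq> u" "m \<noteq> y" for m
    proof (rule ccontr)
      assume "\<not> E m u"
      then have "E u m" using total[of m u] that wuV by blast
      moreover have "m \<noteq> w" using that by auto
      ultimately show False
        using delta[of w v u m y] that wu wuV v yV v_out to_w \<open>E u y\<close> \<open>E y w\<close> by auto
    qed
    have no_right: "\<not> E m w" if "m \<in> ?W" "pos w < pos m" for m
    proof
      assume "E m w"
      moreover have "m \<noteq> w" "m \<noteq> y" using that y by auto
      ultimately show False
        using delta[of w v u m y] that wu wuV v yV v_out[of m] v_out[of y] u_out[of m]
          \<open>E u y\<close> \<open>E y w\<close> y by auto
    qed
    have between: "m = y" if "m \<in> ?W" "pos u < pos m" "pos m < pos w" for m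
      using to_u[of m] u_out[of m] asym[of m u] that wuV by auto
    have order: "pos m < pos u \<or> m = u \<or> m = y \<or> m = w \<or> pos w < pos m" if "m \<in> ?W" for m
      using between[OF that] inj[of m u] inj[of m w] that wu by force
    have single: "single_valued (backs ?W E pos)" "single_valued ((backs ?W E pos)\<inverse>)"
      and injW: "inj_on pos ?W"
      using pavedD(1)[OF paved] by (auto simp: single_back_def)
    have old_w: "(w, b) \<notin> backs ?W E pos" for b
      using no_right[of b] wu unfolding backs_def by auto
    have old_v: "(v, b) \<notin> backs ?W E pos" "(b, v) \<notin> backs ?W E pos" for b
      unfolding backs_def by auto
    have old_uw: "(u, w) \<in> backs ?W E pos"
      using wu unfolding backs_def by auto
    have only_w: "(a, w) \<in> backs ?W E pos \<Longrightarrow> a = u" "(u, a) \<in> backs ?W E pos \<Longrightarrow> a = w" for a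
      using single old_uw unfolding single_valued_def by blast+
    show ?thesis
    proof (cases "\<exists>x \<in> ?W. pos x < pos y \<and> E y x")
      case False
      \<comment> \<open>The triple \<open>u, y, w\<close> becomes \<open>w, u, y\<close>, so that
        its back edge joins \<open>w\<close> and \<open>y\<close>. This respects (P2):
        \<open>y\<close> has no back edge to the left in this case, and \<open>w\<close> none from
        the right. Doubling leaves an odd slot for \<open>w\<close> directly before
        \<open>u\<close>.\<close>
      define pos' where "pos' = (\<lambda>m. 2 * pos m)(v := 2 * c, w := 2 * pos u - 1)"
      have pos': "pos' v = 2 * c" "pos' w = 2 * pos u - 1"
        "\<And>m. m \<noteq> v \<Longrightarrow> m \<noteq> w \<Longrightarrow> pos' m = 2 * pos m"
        using wuV by (auto simp: pos'_def)
      have y_no: "(a, y) \<notin> backs ?W E pos" for a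
        using False unfolding backs_def by auto
      have "backs V E pos' \<subseteq> (backs ?W E pos - {(u, w)}) \<union> {(v, w), (w, y)}"
      proof
        fix e assume "e \<in> backs V E pos'"
        then obtain a b where e: "e = (a, b)" "a \<in> V" "b \<in> V" "pos' a < pos' b" "E b a"
          unfolding backs_def by blast
        consider "a = v" | "b = v" "a \<noteq> v" | "a = w" "b \<noteq> v" | "b = w" "a \<noteq> v" "a \<noteq> w"
          | "a \<in> ?W" "b \<in> ?W" "a \<noteq> w" "b \<noteq> w" using e by blast
        then show "e \<in> (backs ?W E pos - {(u, w)}) \<union> {(v, w), (w, y)}"
        proof cases
          case 1
          then show ?thesis using e in1[of b w] wu by auto
        next
          case 2
          then show ?thesis using e pos' c[of a] c[of u] wuV by (cases "a = w") auto
        next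
          case 3
          then have "b \<noteq> w" "b \<noteq> u" using e 3 asym[of w u] wu irrefl[of w] wuV by auto
          then show ?thesis using 3 e pos' order[of b] no_right[of b] by auto
        next
          case 4
          then show ?thesis using e pos' left[of a u w] wu by auto
        next
          case 5
          then show ?thesis using e pos' unfolding backs_def by auto
        qed
      qed
      moreover have "single_valued ((backs ?W E pos - {(u, w)}) \<union> {(v, w), (w, y)})"
        "single_valued (((backs ?W E pos - {(u, w)}) \<union> {(v, w), (w, y)})\<inverse>)"
        using single old_w old_v only_w(1) y_no wuV yV unfolding single_valued_def by blast+
      moreover have "inj_on pos' V"
      proof (rule inj_onI)
        fix a b assume "a \<in> V" "b \<in> V" "pos' a = pos' b"
        then show "a = b"
          using pos' c[of a] c[of b] c[of u] inj[of a b] wuV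
          by (cases "a = v"; cases "b = v"; cases "a = w"; cases "b = w") (auto, presburger+)
      qed
      ultimately have "single_back V E pos'"
        unfolding single_back_def by (metis converse_mono single_valued_subset)
      then show ?thesis by (rule suff)
    next
      case True
      then obtain x where x: "x \<in> ?W" "pos x < pos y" "E y x" by blast
      have xV: "x \<in> V" "x \<noteq> v" "x \<noteq> y" "x \<noteq> u" "x \<noteq> w"
        using x y asym[of u y] \<open>E u y\<close> wuV by auto
      \<comment> \<open>Otherwise \<open>y -> {x, w} -> {u, z} -> y\<close> is a forbidden
        copy.\<close>
      have y_no: "\<not> E z y" if z: "z \<in> ?W" "pos y < pos z" for z
      proof
        assume "E z y"
        then have "z \<noteq> w" using asym \<open>E y w\<close> yV wuV by blast
        have zV: "z \<in> V" "z \<noteq> y" "z \<noteq> u" "z \<noteq> x" using z x y by auto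
        have "pos w < pos z" using order[OF z(1)] z y \<open>z \<noteq> w\<close> zV by auto
        have "E u z" using u_out z y \<open>z \<noteq> w\<close> by auto
        moreover have "E w z" using no_right[of z] \<open>pos w < pos z\<close> total[of w z] zV z wuV \<open>z \<noteq> w\<close> by auto
        moreover have "E x z"
          using left[of x y z] \<open>E z y\<close> x y z xV zV total[of x z] by auto
        moreover have "E x u" "E x w" using to_u to_w x xV y by auto
        ultimately show False
          using delta[of y x w u z] xV zV wuV yV \<open>E y w\<close> \<open>E u y\<close> \<open>E z y\<close> \<open>E w u\<close> x by auto
      qed
      \<comment> \<open>Here \<open>y\<close> already has its back edge to the left, so the triple
        becomes \<open>y, w, u\<close>: the back edge between \<open>y\<close> and \<open>u\<close>
        is the only one at \<open>y\<close> towards the right, by \<open>y_no\<close>.\<close>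
      define pos' where "pos' = (\<lambda>m. 2 * pos m)(v := 2 * c, u := 2 * pos w + 1)"
      have pos': "pos' v = 2 * c" "pos' u = 2 * pos w + 1"
        "\<And>m. m \<noteq> v \<Longrightarrow> m \<noteq> u \<Longrightarrow> pos' m = 2 * pos m"
        using wuV by (auto simp: pos'_def)
      have old: "(a, u) \<notin> backs ?W E pos" "(y, a) \<notin> backs ?W E pos" for a
      proof -
        show "(a, u) \<notin> backs ?W E pos"
        proof
          assume "(a, u) \<in> backs ?W E pos"
          then have "a \<in> ?W" "pos a < pos u" "E u a" unfolding backs_def by auto
          moreover from this have "a \<noteq> u" "a \<noteq> y" using y by auto
          ultimately show False using to_u[of a] asym[of a u] wu y by auto
        qed
        show "(y, a) \<notin> backs ?W E pos" using y_no unfolding backs_def by auto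
      qed
      have "backs V E pos' \<subseteq> (backs ?W E pos - {(u, w)}) \<union> {(v, w), (y, u)}"
      proof
        fix e assume "e \<in> backs V E pos'"
        then obtain a b where e: "e = (a, b)" "a \<in> V" "b \<in> V" "pos' a < pos' b" "E b a"
          unfolding backs_def by blast
        consider "a = v" | "b = v" "a \<noteq> v" | "a = u" "b \<noteq> v" | "b = u" "a \<noteq> v" "a \<noteq> u"
          | "a \<in> ?W" "b \<in> ?W" "a \<noteq> u" "b \<noteq> u" using e by blast
        then show "e \<in> (backs ?W E pos - {(u, w)}) \<union> {(v, w), (y, u)}"
        proof cases
          case 1
          then show ?thesis using e in1[of b w] wu by auto
        next
          case 2
          then show ?thesis using e pos' c[of a] c[of w] wuV by (cases "a = u") auto
        next
          case 3
          then have "b \<noteq> u" using e irrefl[of u] by auto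
          moreover have "b \<noteq> w" using 3 e pos' \<open>b \<noteq> u\<close> wuV by auto
          ultimately show ?thesis using 3 e pos' u_out[of b] asym[of b u] wu by auto
        next
          case 4
          then have "a \<noteq> w" using e asym wu wuV by blast
          then have "pos a < pos w" using 4 e pos' inj[of a w] wu by auto
          then have "a = y" using 4 e to_u[of a] asym[of u a] wuV by auto
          then show ?thesis using e 4 by simp
        next
          case 5
          then show ?thesis using e pos' unfolding backs_def by auto
        qed
      qed
      moreover have "single_valued ((backs ?W E pos - {(u, w)}) \<union> {(v, w), (y, u)})"
        "single_valued (((backs ?W E pos - {(u, w)}) \<union> {(v, w), (y, u)})\<inverse>)"
        using single old old_v only_w(1) wuV yV unfolding single_valued_def by blast+
      moreover have "inj_on pos' V"
      proof (rule inj_onI)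
        fix a b assume "a \<in> V" "b \<in> V" "pos' a = pos' b"
        then show "a = b"
          using pos' c[of a] c[of b] c[of w] inj[of a b] wuV
          by (cases "a = v"; cases "b = v"; cases "a = u"; cases "b = u") (auto, presburger+)
      qed
      ultimately have "single_back V E pos'"
        unfolding single_back_def by (metis converse_mono single_valued_subset)
      then show ?thesis by (rule suff)
    qed
  qed
qed

end

section \<open>Tournaments without the basic patterns\<close>

text \<open>Asking only for preservation of arcs keeps the pattern lemmas short; for patterns that
  are tournaments, injectivity and preservation of non-arcs follow in
  \<open>embeds_tournament\<close>.\<close>

definition embeds :: "'a set \<Rightarrow> ('a \<Rightarrow> 'a \<Rightarrow> bool) \<Rightarrow> int pair_pre_digraph \<Rightarrow> (int \<Rightarrow> 'a) \<Rightarrow> bool" where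
  "embeds V E S f \<longleftrightarrow> f ` pverts S \<subseteq> V \<and> (\<forall>(i, j) \<in> parcs S. E (f i) (f j))"

lemma embeds_mono: "embeds U E S f \<Longrightarrow> U \<subseteq> V \<Longrightarrow> embeds V E S f"
  unfolding embeds_def by blast

lemma pverts_simps:
  "pverts T5 = {1, 2, 3, 4, 5}" "pverts P7 = {1, 2, 3, 4, 5, 6, 7}"
  "pverts P7_minus = {1, 2, 3, 4, 5, 6}"
  unfolding T5_def P7_def P7_minus_def by auto

lemma parcs_simps:
  "parcs T5 = {(1,2), (1,3), (2,3), (2,4), (3,4), (3,5), (4,5), (4,1), (5,1), (5,2)}"
  "parcs P7 = {(1,2), (1,3), (1,5), (2,3), (2,4), (2,6), (3,4), (3,5), (3,7), (4,5), (4,6), (4,1),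
     (5,6), (5,7), (5,2), (6,7), (6,1), (6,3), (7,1), (7,2), (7,4)}"
  "parcs P7_minus = {(1,2), (1,3), (1,5), (2,3), (2,4), (2,6), (3,4), (3,5), (4,5), (4,6), (4,1),
     (5,6), (5,2), (6,1), (6,3)}"
proof -
  have "parcs T5 = set (filter (\<lambda>(i, j). (j - i) mod 5 \<in> {1, 2}) (List.product [1..5] [1..5]))"
    unfolding T5_def by auto
  also have "\<dots> = {(1,2), (1,3), (2,3), (2,4), (3,4), (3,5), (4,5), (4,1), (5,1), (5,2)}"
    by code_simp
  finally show "parcs T5 = \<dots>" .
  have "parcs P7 = set (filter (\<lambda>(i, j). (j - i) mod 7 \<in> {1, 2, 4}) (List.product [1..7] [1..7]))"
    unfolding P7_def by auto
  also have "\<dots> = {(1,2), (1,3), (1,5), (2,3), (2,4), (2,6), (3,4), (3,5), (3,7), (4,5), (4,6), (4,1),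
     (5,6), (5,7), (5,2), (6,7), (6,1), (6,3), (7,1), (7,2), (7,4)}"
    by code_simp
  finally show P7: "parcs P7 = \<dots>" .
  show "parcs P7_minus = {(1,2), (1,3), (1,5), (2,3), (2,4), (2,6), (3,4), (3,5), (4,5), (4,6), (4,1),
     (5,6), (5,2), (6,1), (6,3)}"
    unfolding P7_minus_def by (auto simp: P7)
qed

lemma embeds_T5I:
  assumes "{a, b, c, d, e} \<subseteq> V"
    "E a b" "E a c" "E b c" "E b d" "E c d" "E c e" "E d e" "E d a" "E e a" "E e b"
  shows "\<exists>f. embeds V E T5 f"
  by (rule exI[of _ "(\<lambda>i. a)(2 := b, 3 := c, 4 := d, 5 := e)"])
    (use assms in \<open>auto simp: embeds_def pverts_simps parcs_simps\<close>)

lemma embeds_P7_minusI: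
  assumes "{a, b, c, d, e, g} \<subseteq> V"
    "E a b" "E a c" "E a e" "E b c" "E b d" "E b g" "E c d" "E c e" "E d e" "E d g" "E d a"
    "E e g" "E e b" "E g a" "E g c"
  shows "\<exists>f. embeds V E P7_minus f"
  by (rule exI[of _ "(\<lambda>i. a)(2 := b, 3 := c, 4 := d, 5 := e, 6 := g)"])
    (use assms in \<open>auto simp: embeds_def pverts_simps parcs_simps\<close>)

section \<open>A vertex of in-degree or out-degree at most one\<close>

context delta_free_tour
begin

text \<open>
  Otherwise some \<open>v\<close> has in-degree two, and the last vertex \<open>s\<close> of a paving ordering of \<open>V - {v}\<close> is
  an in-neighbour of \<open>v\<close>. The cases below are the possible positions of the other in-neighbour \<open>r\<close>
  relative to the out-neighbour \<open>t\<close> of \<open>s\<close>; each exhibits a forbidden subtournament.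
\<close>

lemma ex_low_degree:
  assumes "V \<noteq> {}" and paved: "\<And>v. v \<in> V \<Longrightarrow> \<exists>pos. paved (V - {v}) E pos"
    and no_T5: "\<nexists>f. embeds V E T5 f" and no_P7_minus: "\<nexists>f. embeds V E P7_minus f"
  shows "\<exists>v \<in> V. (\<forall>p \<in> V. \<forall>q \<in> V. E p v \<longrightarrow> E q v \<longrightarrow> p = q) \<or>
    (\<forall>p \<in> V. \<forall>q \<in> V. E v p \<longrightarrow> E v q \<longrightarrow> p = q)"
proof (rule ccontr)
  assume neg: "\<not> ?thesis"
  then have in2: "\<exists>q \<in> V. q \<noteq> p \<and> E q v" if "v \<in> V" for v p using that by metis
  from neg have out2: "\<exists>q \<in> V. q \<noteq> p \<and> E v q" if "v \<in> V" for v p using that by metis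
  \<comment> \<open>The first vertex \<open>v\<close> of a paving ordering of \<open>V - {x}\<close>
    has at most one in-neighbour there by (P2), hence at most two in \<open>V\<close>, and by
    \<open>neg\<close> exactly two.\<close>
  obtain x where x: "x \<in> V" using \<open>V \<noteq> {}\<close> by blast
  obtain pos0 where pos0: "paved (V - {x}) E pos0" using paved x by blast
  have "V - {x} \<noteq> {}" "finite (V - {x})" using in2[OF x, of x] fin by auto
  then obtain v where v: "v \<in> V - {x}" "\<And>m. m \<in> V - {x} \<Longrightarrow> pos0 v \<le> pos0 m"
    using arg_min_if_finite[of "V - {x}" pos0] by (metis linorder_not_less)
  have vV: "v \<in> V" using v by blast
  have "\<exists>q. \<forall>m \<in> V. E m v \<longrightarrow> m = x \<or> m = q"
  proof -
    have "m = q" if "m \<in> V - {x}" "q \<in> V - {x}" "E m v" "E q v" for m q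
    proof -
      have "m \<noteq> v" "q \<noteq> v" using that irrefl vV by auto
      then have "pos0 v < pos0 m" "pos0 v < pos0 q"
        using v that single_backD(1)[OF pavedD(1)[OF pos0]] by (metis order_le_less)+
      then show ?thesis using single_backD(3)[OF pavedD(1)[OF pos0]] that v(1) by blast
    qed
    then show ?thesis by (metis DiffI singletonD)
  qed
  then obtain q where q: "\<And>m. m \<in> V \<Longrightarrow> E m v \<Longrightarrow> m = x \<or> m = q" by blast
  let ?W = "V - {v}"
  obtain pos where pos: "paved ?W E pos" using paved vV by blast
  note inj = single_backD(1)[OF pavedD(1)[OF pos]]
  note left = single_backD(2)[OF pavedD(1)[OF pos]]
  note right = single_backD(3)[OF pavedD(1)[OF pos]]
  have "?W \<noteq> {}" "finite ?W" using in2[OF vV, of v] fin by auto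
  then obtain s where s: "s \<in> ?W" "\<And>m. m \<in> ?W \<Longrightarrow> pos m \<le> pos s"
    using arg_min_if_finite[of "?W" "\<lambda>m. - pos m"] by (metis linorder_not_less neg_le_iff_le)
  have sV: "s \<in> V" "s \<noteq> v" using s by auto
  have s_left: "pos m < pos s" if "m \<in> ?W" "m \<noteq> s" for m
    using s(2)[OF that(1)] inj[of m s] that s(1) by force
  have s_out1: "m = m'" if "m \<in> ?W" "m' \<in> ?W" "E s m" "E s m'" for m m'
  proof -
    have "m \<noteq> s" "m' \<noteq> s" using that irrefl[OF sV(1)] by auto
    then show ?thesis using left[of m m' s] that s s_left by auto
  qed
  \<comment> \<open>By (P2) the last vertex \<open>s\<close> beats at most one vertex of
    \<open>?W\<close>; its second out-neighbour must be \<open>v\<close>.\<close>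
  have "E s v"
  proof (rule ccontr)
    assume no: "\<not> E s v"
    obtain m where "m \<in> V" "E s m" using out2[OF sV(1)] by blast
    moreover obtain m' where "m' \<in> V" "m' \<noteq> m" "E s m'" using out2[OF sV(1)] by blast
    ultimately show False using s_out1[of m m'] no by auto
  qed
  obtain r where r: "r \<in> V" "r \<noteq> s" "E r v" using in2[OF vV] by blast
  have v_in: "m = r \<or> m = s" if "m \<in> V" "E m v" for m
    using q[OF that] q[OF r(1,3)] q[OF sV(1) \<open>E s v\<close>] r(2) by auto
  obtain t where t: "t \<in> V" "t \<noteq> v" "E s t" using out2[OF sV(1)] by blast
  have "r \<noteq> v" "t \<noteq> s" using irrefl r t vV by auto
  have "pos t < pos s" using s_left t \<open>t \<noteq> s\<close> by auto
  have v_out: "E v m" if "m \<in> V" "m \<noteq> v" "m \<noteq> r" "m \<noteq> s" for m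
    using v_in[of m] total[of v m] that vV by auto
  have to_s: "E m s" if "m \<in> V" "m \<noteq> v" "m \<noteq> s" "m \<noteq> t" for m
    using s_out1[of m t] total[of s m] that t sV by auto
  have t_out: "E t m" if "m \<in> ?W" "pos t < pos m" "m \<noteq> s" for m
    using right[of m s t] total[of t m] that t s \<open>pos t < pos s\<close> by auto
  \<comment> \<open>Two such vertices would give \<open>s -> {v, t} -> {m, m'} -> s\<close>.\<close>
  have after_t: "m = m'" if "m \<in> V" "m \<noteq> v" "m \<noteq> r" "m \<noteq> s" "pos t < pos m"
    "m' \<in> V" "m' \<noteq> v" "m' \<noteq> r" "m' \<noteq> s" "pos t < pos m'" for m m'
    using delta[of s v t m m'] that t v_out[of m] v_out[of m'] t_out[of m] t_out[of m']
      to_s[of m] to_s[of m'] sV vV \<open>E s v\<close> by auto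
  have before_t: "pos m < pos t" if "m \<in> V" "m \<noteq> v" "m \<noteq> r" "m \<noteq> s" "m \<noteq> t"
    "a \<in> V" "a \<noteq> v" "a \<noteq> r" "a \<noteq> s" "pos t < pos a" "m \<noteq> a" for m a
    using after_t[of m a] inj[of m t] that t by force
  \<comment> \<open>Two such vertices would give \<open>v -> {m, m'} -> {r, s} -> v\<close>.\<close>
  have to_r: "m = m'" if "m \<in> V" "m \<noteq> v" "m \<noteq> s" "m \<noteq> t" "E m r"
    "m' \<in> V" "m' \<noteq> v" "m' \<noteq> s" "m' \<noteq> t" "E m' r" for m m'
  proof -
    have "m \<noteq> r" "m' \<noteq> r" using that irrefl[OF r(1)] by auto
    then show ?thesis
      using delta[of v m m' r s] that v_out[of m] v_out[of m'] to_s[of m] to_s[of m'] r sV vV \<open>E s v\<close>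
      by auto
  qed
  \<comment> \<open>Condition (P1) for the back edge from \<open>s\<close> to
    \<open>t\<close>.\<close>
  obtain a0 where a0: "a0 \<in> V" "a0 \<noteq> v" "a0 \<noteq> s" "pos t < pos a0"
    using pavedD(2)[OF pos, of t s] t s \<open>pos t < pos s\<close> by force
  consider "t = r" | "t \<noteq> r" "pos t < pos r" | "pos r < pos t"
    using inj[of r t] r t \<open>r \<noteq> v\<close> by force
  then show False
  proof cases
    case 1
    have a: "a0 \<noteq> r" using a0 1 by auto
    have "E v a0" "E a0 s" "E r a0" using v_out to_s t_out a0 a 1 by auto
    \<comment> \<open>A second out-neighbour of \<open>a0\<close> has to lie before
      \<open>r\<close>. Its only back edge comes from \<open>a0\<close>, so it beats
      \<open>r\<close>, and it is the missing vertex of a \<open>T5\<close>.\<close>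
    obtain y where y: "y \<in> V" "y \<noteq> s" "E a0 y" using out2[OF a0(1)] by blast
    have y': "y \<noteq> v" "y \<noteq> r" "y \<noteq> a0"
      using y asym a0(1) r(1) vV irrefl[of a0] \<open>E v a0\<close> \<open>E r a0\<close> by blast+
    have "pos y < pos r" using before_t[of y a0] y y' a0 a 1 by auto
    have "E y r" using right[of r a0 y] total[of r y] y y' a0 a r \<open>pos y < pos r\<close> 1 \<open>r \<noteq> v\<close> by auto
    moreover have "E v y" "E y s" using v_out to_s y y' 1 by auto
    ultimately show False
      using no_T5 embeds_T5I[of y s r v a0 V E] y a0 r sV vV t 1 \<open>E s v\<close> \<open>E v a0\<close> \<open>E a0 s\<close> \<open>E r a0\<close>
      by auto
  next
    case 2
    have "E v t" "E r s" "E t r" using v_out to_s t_out r t 2 \<open>r \<noteq> v\<close> \<open>t \<noteq> s\<close> by auto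
    show False
    proof (cases "\<exists>a \<in> V. a \<noteq> v \<and> a \<noteq> r \<and> a \<noteq> s \<and> pos t < pos a")
      case True
      then obtain a where a: "a \<in> V" "a \<noteq> v" "a \<noteq> r" "a \<noteq> s" "pos t < pos a" by blast
      then have "a \<noteq> t" by auto
      then have arcs: "E v a" "E a s" "E t a" using v_out to_s t_out a by auto
      show False
      proof (cases "E a r")
        case True
        then show False
          using no_T5 embeds_T5I[of t a r s v V E] a r sV vV t \<open>E s v\<close> arcs
            \<open>E v t\<close> \<open>E r s\<close> \<open>E t r\<close> by auto
      next
        case False
        then have "E r a" using total a r by blast
        \<comment> \<open>As the only back edge into \<open>y\<close> comes from \<open>a\<close>,
          it beats both \<open>r\<close> and \<open>t\<close>, and completes a
          \<open>P7_minus\<close>.\<close>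
        obtain y where y: "y \<in> V" "y \<noteq> s" "E a y" using out2[OF a(1)] by blast
        have y': "y \<noteq> v" "y \<noteq> r" "y \<noteq> a" "y \<noteq> t"
          using y asym a(1) r(1) t(1) vV irrefl[of a] arcs \<open>E r a\<close> by blast+
        have "pos y < pos t" using before_t[of y a] y y' a by auto
        then have "E y r" "E y t"
          using right[of r a y] right[of t a y] total[of r y] total[of t y] y y' a r t \<open>a \<noteq> t\<close> 2 \<open>r \<noteq> v\<close>
          by auto
        moreover have "E v y" "E y s" using v_out to_s y y' by auto
        ultimately show False
          using no_P7_minus embeds_P7_minusI[of y r s v t a V E] a y r sV vV t \<open>E s v\<close> arcs
            \<open>E v t\<close> \<open>E r s\<close> \<open>E t r\<close> \<open>E r a\<close> by auto
      qed
    next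
      case False
      obtain y where y: "y \<in> V" "y \<noteq> r" "E t y" using out2[OF t(1)] by blast
      have y': "y \<noteq> v" "y \<noteq> s" "y \<noteq> t"
        using y asym t vV sV irrefl[of t] \<open>E v t\<close> by blast+
      then have "pos y < pos t" using False inj[of y t] y t by force
      then have "E y r"
        using right[of r t y] total[of r y] y y' r t 2 \<open>r \<noteq> v\<close> by auto
      moreover have "E v y" "E y s" using v_out to_s y y' by auto
      ultimately show False
        using no_T5 embeds_T5I[of y r s v t V E] y r sV vV t \<open>E s v\<close> \<open>E v t\<close> \<open>E r s\<close> \<open>E t r\<close> by auto
    qed
  next
    case 3
    then have "t \<noteq> r" "a0 \<noteq> r" "a0 \<noteq> t" using a0 by auto
    have arcs: "E v t" "E r s" "E v a0" "E a0 s" "E t a0"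
      using v_out to_s t_out r t a0 \<open>r \<noteq> v\<close> \<open>t \<noteq> s\<close> \<open>t \<noteq> r\<close> \<open>a0 \<noteq> r\<close> \<open>a0 \<noteq> t\<close> by auto
    have r_in: "m \<noteq> v" "m \<noteq> s" "m \<noteq> r" if "m \<in> V" "E m r" for m
      using that asym r(1,3) vV sV(1) irrefl[of r] arcs by blast+
    obtain m where m: "m \<in> V" "E m r" using in2[OF r(1)] by blast
    obtain m' where m': "m' \<in> V" "m' \<noteq> m" "E m' r" using in2[OF r(1)] by blast
    \<comment> \<open>By \<open>to_r\<close>, two in-neighbours of \<open>r\<close> cannot both
      differ from \<open>t\<close>.\<close>
    have "E t r" using to_r[of m m'] r_in m m' by blast
    obtain d where d: "d \<in> V" "d \<noteq> t" "E d r" using in2[OF r(1)] by blast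
    have d': "d \<noteq> v" "d \<noteq> s" "d \<noteq> r" using r_in d by auto
    have "E r a0"
      using right[of a0 t r] total[of r a0] 3 a0 r t \<open>E t r\<close> \<open>a0 \<noteq> r\<close> \<open>a0 \<noteq> t\<close> \<open>r \<noteq> v\<close> by auto
    have "pos d < pos r"
      using right[of d t r] inj[of d r] 3 d d' r t \<open>E t r\<close> \<open>r \<noteq> v\<close> by force
    have "E d t"
      using left[of r d t] total[of d t] 3 d d' r t \<open>E t r\<close> \<open>r \<noteq> v\<close> \<open>pos d < pos r\<close> by auto
    have "E v d" "E d s" using v_out to_s d d' by auto
    \<comment> \<open>Besides \<open>v\<close>, some \<open>w\<close> beats \<open>d\<close>. If
      \<open>w\<close> is \<open>a0\<close>, there is a \<open>P7_minus\<close>; otherwise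
      \<open>r -> {v, w} -> {d, t} -> r\<close> is forbidden.\<close>
    obtain w where w: "w \<in> V" "w \<noteq> v" "E w d" using in2[OF d(1)] by blast
    have w': "w \<noteq> s" "w \<noteq> r" "w \<noteq> t" "w \<noteq> d"
      using w asym d r(1) t(1) sV(1) irrefl[of d] \<open>E d t\<close> \<open>E d s\<close> by blast+
    have "E v w" using v_out w w' by auto
    have "E r w" using to_r[of w d] total[of r w] w w' d d' r by auto
    show False
    proof (cases "w = a0")
      case True
      then show False
        using no_P7_minus embeds_P7_minusI[of d r s v t a0 V E] a0 d w r sV vV t \<open>E s v\<close> arcs
            \<open>E t r\<close> \<open>E r a0\<close> \<open>E d t\<close> \<open>E v d\<close> \<open>E d s\<close> by auto
    next
      case False
      then have "pos w < pos t" using before_t[of w a0] w w' a0 \<open>a0 \<noteq> r\<close> by auto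
      then have "E w t"
        using left[of r w t] total[of w t] 3 w w' r t \<open>E t r\<close> \<open>r \<noteq> v\<close> by auto
      then show False
        using delta[of r v w d t] r vV w w' d t \<open>E r w\<close> \<open>E v d\<close> \<open>E v t\<close> \<open>E t r\<close> by auto
    qed
  qed
qed

end

lemma ex_paved:
  assumes "delta_free_tour V E" "\<nexists>f. embeds V E T5 f" "\<nexists>f. embeds V E P7_minus f"
  shows "\<exists>pos. paved V E pos"
proof -
  have "finite V" using assms(1) by (rule delta_free_tour.fin)
  then show ?thesis using assms
  proof (induction V rule: finite_psubset_induct)
    case (psubset V)
    interpret delta_free_tour V E by (rule psubset.prems)
    have sub: "\<exists>pos. paved (V - {v}) E pos" if "v \<in> V" for v
    proof (rule psubset.IH)
      show "V - {v} \<subset> V" using that by blast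
      show "delta_free_tour (V - {v}) E" by (rule subset) blast
    qed (use psubset.prems(2,3) embeds_mono[of "V - {v}" E _ _ V] in blast)+
    show ?case
    proof (cases "V = {}")
      case True
      then show ?thesis by (auto simp: paved_def single_back_def backs_def)
    next
      case False
      obtain v where v: "v \<in> V" and
        "(\<forall>p \<in> V. \<forall>q \<in> V. E p v \<longrightarrow> E q v \<longrightarrow> p = q) \<or>
         (\<forall>p \<in> V. \<forall>q \<in> V. E v p \<longrightarrow> E v q \<longrightarrow> p = q)"
        using ex_low_degree[OF False sub psubset.prems(2,3)] by blast
      then consider "\<forall>p \<in> V. \<forall>q \<in> V. E p v \<longrightarrow> E q v \<longrightarrow> p = q"
        | "\<forall>p \<in> V. \<forall>q \<in> V. E v p \<longrightarrow> E v q \<longrightarrow> p = q" by blast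
      then show ?thesis
      proof cases
        case 1
        then show ?thesis using sub[OF v] ex_paved_insert[OF v] by blast
      next
        case 2
        obtain pos where "paved (V - {v}) E pos" using sub[OF v] by blast
        \<comment> \<open>Out-degree at most one becomes in-degree at most one after reversal; the
          ordering found for the reversed tournament is reversed back.\<close>
        then have "paved (V - {v}) (\<lambda>x y. E y x) (\<lambda>x. - pos x)" by (rule paved_converse)
        then obtain pos' where "paved V (\<lambda>x y. E y x) pos'"
          using delta_free_tour.ex_paved_insert[OF converse v] 2 by blast
        then show ?thesis using paved_converse[of V "\<lambda>x y. E y x" pos'] by auto
      qed
    qed
  qed
qed

section \<open>Attachments to the basic patterns\<close>

context delta_free_tour
begin

text \<open>
  The instances of \<open>delta\<close> used below were found by computer; modulo rotation there are two of them for
  each of \<open>T5\<close> and \<open>P7\<close>.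
\<close>

lemma T5_homogeneous:
  assumes emb: "embeds V E T5 f" and w: "w \<in> V" "w \<notin> f ` pverts T5"
  shows "(\<forall>i \<in> pverts T5. E w (f i)) \<or> (\<forall>i \<in> pverts T5. E (f i) w)"
proof -
  have "\<forall>i \<in> pverts T5. f i \<in> V \<and> w \<noteq> f i \<and> f i \<noteq> w"
    using emb w unfolding embeds_def by auto
  note f = this[unfolded pverts_simps, simplified]
  have "\<forall>(i, j) \<in> parcs T5. E (f i) (f j)"
    using emb unfolding embeds_def by blast
  note arc = this[unfolded parcs_simps, simplified]
  have "\<forall>(i, j) \<in> parcs T5. f i \<noteq> f j \<and> f j \<noteq> f i"
    unfolding parcs_simps using f arc irrefl by simp metis
  note distinct = this[unfolded parcs_simps, simplified]
  have "\<forall>i \<in> pverts T5. E (f i) w \<longleftrightarrow> \<not> E w (f i)"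
    by (intro ballI total) (use emb w in \<open>auto simp: embeds_def\<close>)
  note into = this[unfolded pverts_simps, simplified]
  note clauses = delta[of "f 1" w "f 3" "f 4" "f 5"]
    delta[of "f 1" "f 2" "f 3" w "f 4"]
    delta[of "f 2" w "f 4" "f 5" "f 1"]
    delta[of "f 2" "f 3" "f 4" w "f 5"]
    delta[of "f 3" w "f 5" "f 1" "f 2"]
    delta[of "f 3" "f 4" "f 5" w "f 1"]
    delta[of "f 4" w "f 1" "f 2" "f 3"]
    delta[of "f 4" "f 5" "f 1" w "f 2"]
    delta[of "f 5" w "f 2" "f 3" "f 4"]
    delta[of "f 5" "f 1" "f 2" w "f 3"]
  \<comment> \<open>Once known arcs and inequalities are simplified away, the instances are
    propositional clauses over the atoms \<open>E w (f i)\<close>, satisfied only by the two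
    constant assignments.\<close>
  show ?thesis
    using clauses[simplified f arc distinct into w simp_thms] unfolding pverts_simps
    by (simp add: into) argo
qed

lemma P7_homogeneous:
  assumes emb: "embeds V E P7 f" and w: "w \<in> V" "w \<notin> f ` pverts P7"
  shows "(\<forall>i \<in> pverts P7. E w (f i)) \<or> (\<forall>i \<in> pverts P7. E (f i) w)"
proof -
  have "\<forall>i \<in> pverts P7. f i \<in> V \<and> w \<noteq> f i \<and> f i \<noteq> w"
    using emb w unfolding embeds_def by auto
  note f = this[unfolded pverts_simps, simplified]
  have "\<forall>(i, j) \<in> parcs P7. E (f i) (f j)"
    using emb unfolding embeds_def by blast
  note arc = this[unfolded parcs_simps, simplified]
  have "\<forall>(i, j) \<in> parcs P7. f i \<noteq> f j \<and> f j \<noteq> f i"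
    unfolding parcs_simps using f arc irrefl by simp metis
  note distinct = this[unfolded parcs_simps, simplified]
  have "\<forall>i \<in> pverts P7. E (f i) w \<longleftrightarrow> \<not> E w (f i)"
    by (intro ballI total) (use emb w in \<open>auto simp: embeds_def\<close>)
  note into = this[unfolded pverts_simps, simplified]
  note clauses = delta[of "f 1" w "f 2" "f 4" "f 6"]
    delta[of "f 1" "f 2" "f 3" w "f 4"]
    delta[of "f 2" w "f 3" "f 5" "f 7"]
    delta[of "f 2" "f 3" "f 4" w "f 5"]
    delta[of "f 3" w "f 4" "f 6" "f 1"]
    delta[of "f 3" "f 4" "f 5" w "f 6"]
    delta[of "f 4" w "f 5" "f 7" "f 2"]
    delta[of "f 4" "f 5" "f 6" w "f 7"]
    delta[of "f 5" w "f 6" "f 1" "f 3"]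
    delta[of "f 5" "f 6" "f 7" w "f 1"]
    delta[of "f 6" w "f 7" "f 2" "f 4"]
    delta[of "f 6" "f 7" "f 1" w "f 2"]
    delta[of "f 7" w "f 1" "f 3" "f 5"]
    delta[of "f 7" "f 1" "f 2" w "f 3"]
  show ?thesis
    using clauses[simplified f arc distinct into w simp_thms] unfolding pverts_simps
    by (simp add: into) argo
qed

text \<open>The twelve instances form four orbits under doubling modulo 7, an automorphism of
  \<open>P7_minus\<close> that rotates \<open>{1, 2, 4}\<close> and \<open>{3, 5, 6}\<close>. The
  last alternative is how vertex 7 is attached in \<open>P7\<close>.\<close>

lemma P7_minus_attachments:
  assumes emb: "embeds V E P7_minus f" and w: "w \<in> V" "w \<notin> f ` pverts P7_minus"
  shows "(\<forall>i \<in> pverts P7_minus. E w (f i)) \<or> (\<forall>i \<in> pverts P7_minus. E (f i) w) \<or>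
    (\<forall>i \<in> {1, 2, 4}. E (f i) w) \<and> (\<forall>i \<in> {3, 5, 6}. E w (f i)) \<or>
    (\<forall>i \<in> {1, 2, 4}. E w (f i)) \<and> (\<forall>i \<in> {3, 5, 6}. E (f i) w)"
proof -
  have "\<forall>i \<in> pverts P7_minus. f i \<in> V \<and> w \<noteq> f i \<and> f i \<noteq> w"
    using emb w unfolding embeds_def by auto
  note f = this[unfolded pverts_simps, simplified]
  have "\<forall>(i, j) \<in> parcs P7_minus. E (f i) (f j)"
    using emb unfolding embeds_def by blast
  note arc = this[unfolded parcs_simps, simplified]
  have "\<forall>(i, j) \<in> parcs P7_minus. f i \<noteq> f j \<and> f j \<noteq> f i"
    unfolding parcs_simps using f arc irrefl by simp metis
  note distinct = this[unfolded parcs_simps, simplified]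
  have "\<forall>i \<in> pverts P7_minus. E (f i) w \<longleftrightarrow> \<not> E w (f i)"
    by (intro ballI total) (use emb w in \<open>auto simp: embeds_def\<close>)
  note into = this[unfolded pverts_simps, simplified]
  note clauses = delta[of "f 1" w "f 2" "f 4" "f 6"]
    delta[of "f 2" w "f 4" "f 1" "f 5"]
    delta[of "f 4" w "f 1" "f 2" "f 3"]
    delta[of "f 1" "f 2" "f 5" w "f 6"]
    delta[of "f 2" "f 3" "f 4" w "f 5"]
    delta[of "f 4" "f 1" "f 6" w "f 3"]
    delta[of "f 3" w "f 4" "f 1" "f 6"]
    delta[of "f 5" w "f 2" "f 3" "f 4"]
    delta[of "f 6" w "f 1" "f 2" "f 5"]
    delta[of "f 3" "f 4" "f 5" w "f 6"]
    delta[of "f 5" "f 2" "f 6" w "f 3"]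
    delta[of "f 6" "f 1" "f 3" w "f 5"]
  show ?thesis
    using clauses[simplified f arc distinct into w simp_thms] unfolding pverts_simps
    by (simp add: into) argo
qed

end

section \<open>Induced tournaments and isomorphisms\<close>

text \<open>The induced subdigraph as a pair digraph, the type that \<open>tournament\<close>
  expects; \<open>with_proj_induced\<close> links it to the operation in
  \<open>contains_copy\<close>.\<close>

definition induced :: "'a pair_pre_digraph \<Rightarrow> 'a set \<Rightarrow> 'a pair_pre_digraph" where
  "induced G U = \<lparr> pverts = U, parcs = parcs G \<inter> U \<times> U \<rparr>"

lemma induced_simps [simp]:
  "pverts (induced G U) = U" "(a, b) \<in> parcs (induced G U) \<longleftrightarrow> (a, b) \<in> parcs G \<and> a \<in> U \<and> b \<in> U"
  by (auto simp: induced_def)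

lemma with_proj_induced: "with_proj (induced G U) = with_proj G \<restriction> U"
  unfolding induced_def with_proj_def induce_subgraph_def by auto

lemma tournament_induced:
  assumes "tournament G" "U \<subseteq> pverts G"
  shows "tournament (induced G U)"
proof -
  interpret tournament G by fact
  show ?thesis
  proof
    show "finite (pverts (induced G U))" using finite_subset[OF assms(2) pair_finite_verts] by simp
    show "finite (parcs (induced G U))" using pair_finite_arcs by (simp add: induced_def)
    show "(u, v) \<in> parcs (induced G U) \<longleftrightarrow> (v, u) \<notin> parcs (induced G U)"
      if "u \<in> pverts (induced G U)" "v \<in> pverts (induced G U)" "u \<noteq> v" for u v
      using one_direction[of u v] that assms(2) by auto
    show "fst e \<noteq> snd e" if "e \<in> parcs (induced G U)" for e
      using pair_no_loops that by (auto simp: induced_def)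
  qed (auto simp: induced_def)
qed

lemma free_of_induced:
  assumes "free_of G S" "U \<subseteq> pverts G"
  shows "free_of (induced G U) S"
proof
  assume "contains_copy (induced G U) S"
  then obtain X where X: "X \<subseteq> U" "digraph_iso (with_proj (induced G U) \<restriction> X) S"
    unfolding contains_copy_def by auto
  have "with_proj (induced G U) \<restriction> X = with_proj G \<restriction> X"
    using X(1) unfolding induced_def with_proj_def induce_subgraph_def by auto
  then show False using X assms unfolding contains_copy_def by auto
qed

lemma digraph_isoI:
  assumes "tournament G" "bij_betw h (pverts G) (pverts H)" "parcs H \<subseteq> pverts H \<times> pverts H"
    and arcs: "\<And>a b. \<lbrakk>a \<in> pverts G; b \<in> pverts G\<rbrakk> \<Longrightarrow> (a, b) \<in> parcs G \<longleftrightarrow> (h a, h b) \<in> parcs H"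
  shows "digraph_iso (with_proj G) (with_proj H)"
proof -
  interpret tournament G by fact
  let ?f = "\<lparr> iso_verts = h, iso_arcs = map_prod h h, iso_head = snd, iso_tail = fst \<rparr>"
  have inj: "inj_on h (pverts G)" and im: "h ` pverts G = pverts H"
    using assms(2) by (auto simp: bij_betw_def)
  have sub: "parcs G \<subseteq> pverts G \<times> pverts G" using in_arcsD1 in_arcsD2 by auto
  have "inj_on (map_prod h h) (parcs G)"
    by (rule inj_on_subset[OF map_prod_inj_on[OF inj inj] sub])
  then have "digraph_isomorphism ?f"
    unfolding digraph_isomorphism_def using inj wf_digraph by auto
  moreover have "map_prod h h ` parcs G = parcs H"
  proof
    show "map_prod h h ` parcs G \<subseteq> parcs H" using arcs sub by auto
    show "parcs H \<subseteq> map_prod h h ` parcs G"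
    proof
      fix e assume e: "e \<in> parcs H"
      then obtain a b where "a \<in> pverts G" "b \<in> pverts G" "e = (h a, h b)"
        using assms(3) unfolding im[symmetric] by blast
      then show "e \<in> map_prod h h ` parcs G" using arcs e by force
    qed
  qed
  ultimately show ?thesis
    unfolding digraph_iso_def by (intro exI[of _ ?f]) (auto simp: app_iso_def with_proj_def im)
qed

text \<open>Serves to show that \<open>T5\<close> and \<open>P7\<close> themselves are
  \<open>basic\<close>, which is defined by isomorphism.\<close>

lemma digraph_iso_refl:
  assumes "parcs H \<subseteq> pverts H \<times> pverts H"
  shows "digraph_iso (with_proj H) (with_proj H)"
proof -
  let ?f = "\<lparr> iso_verts = id, iso_arcs = id, iso_head = snd, iso_tail = fst \<rparr>"
  have "wf_digraph (with_proj H)"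
    using assms by unfold_locales auto
  then have "pre_digraph.digraph_isomorphism (with_proj H) ?f"
    unfolding pre_digraph.digraph_isomorphism_def by simp
  then show ?thesis
    unfolding digraph_iso_def by (intro exI[of _ ?f]) (simp add: app_iso_def with_proj_def)
qed

lemma contains_copyI:
  assumes "tournament G" "X \<subseteq> pverts G" "bij_betw h X (pverts S)" "parcs S \<subseteq> pverts S \<times> pverts S"
    and "\<And>a b. \<lbrakk>a \<in> X; b \<in> X\<rbrakk> \<Longrightarrow> (a, b) \<in> parcs G \<longleftrightarrow> (h a, h b) \<in> parcs S"
  shows "contains_copy G S"
proof -
  have "digraph_iso (with_proj (induced G X)) (with_proj S)"
    by (rule digraph_isoI[OF tournament_induced[OF assms(1,2)]]) (use assms in auto)
  then show ?thesis using assms(2) unfolding contains_copy_def with_proj_induced by auto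
qed

section \<open>Copies of patterns in tournaments\<close>

abbreviation beats :: "'a pair_pre_digraph \<Rightarrow> 'a \<Rightarrow> 'a \<Rightarrow> bool" where
  "beats G u v \<equiv> (u, v) \<in> parcs G"

text \<open>Two vertices with the same image would turn the arc between them into a loop. For
  distinct vertices a non-arc of \<open>S\<close> is a reversed arc, whose image excludes the
  opposite arc.\<close>

lemma embeds_tournament:
  assumes "tournament G" "embeds (pverts G) (beats G) S f"
    and tot: "\<And>i j. \<lbrakk>i \<in> pverts S; j \<in> pverts S; i \<noteq> j\<rbrakk> \<Longrightarrow> (i, j) \<in> parcs S \<or> (j, i) \<in> parcs S"
    and irr: "\<And>i. (i, i) \<notin> parcs S"
  shows "inj_on f (pverts S)"
    and "\<lbrakk>i \<in> pverts S; j \<in> pverts S\<rbrakk> \<Longrightarrow> (f i, f j) \<in> parcs G \<longleftrightarrow> (i, j) \<in> parcs S"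
proof -
  interpret tournament G by fact
  have mem: "f i \<in> pverts G" if "i \<in> pverts S" for i
    using assms(2) that unfolding embeds_def by auto
  have arcs: "(f i, f j) \<in> parcs G" if "(i, j) \<in> parcs S" for i j
    using assms(2) that unfolding embeds_def by auto
  show inj: "inj_on f (pverts S)"
  proof (rule inj_onI, rule ccontr)
    fix i j assume "i \<in> pverts S" "j \<in> pverts S" "f i = f j" "i \<noteq> j"
    then show False using tot[of i j] arcs[of i j] arcs[of j i] no_loops' by auto
  qed
  show "(f i, f j) \<in> parcs G \<longleftrightarrow> (i, j) \<in> parcs S" if ij: "i \<in> pverts S" "j \<in> pverts S"
  proof (cases "i = j")
    case True
    then show ?thesis using irr no_loops' by auto
  next
    case False
    then have "f i \<noteq> f j" using inj ij by (auto dest: inj_onD)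
    then show ?thesis
      using one_direction[OF mem[OF ij(1)] mem[OF ij(2)]] tot[OF ij False] arcs by blast
  qed
qed

lemma patterns_total:
  assumes "S \<in> {T5, P7, P7_minus}"
  shows "\<lbrakk>i \<in> pverts S; j \<in> pverts S; i \<noteq> j\<rbrakk> \<Longrightarrow> (i, j) \<in> parcs S \<or> (j, i) \<in> parcs S"
    and "(i, i) \<notin> parcs S"
    and "parcs S \<subseteq> pverts S \<times> pverts S"
    and "{1, 2} \<subseteq> pverts S"
proof -
  have "\<forall>i \<in> pverts S. \<forall>j \<in> pverts S. i \<noteq> j \<longrightarrow> (i, j) \<in> parcs S \<or> (j, i) \<in> parcs S"
    using assms by (elim insertE emptyE; simp only: pverts_simps parcs_simps; simp)
  then show "\<lbrakk>i \<in> pverts S; j \<in> pverts S; i \<noteq> j\<rbrakk> \<Longrightarrow> (i, j) \<in> parcs S \<or> (j, i) \<in> parcs S"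
    by blast
  have "\<forall>(i, j) \<in> parcs S. i \<noteq> j"
    using assms by (elim insertE emptyE; simp add: parcs_simps)
  then show "(i, i) \<notin> parcs S" by blast
  show "parcs S \<subseteq> pverts S \<times> pverts S" "{1, 2} \<subseteq> pverts S"
    using assms by (elim insertE emptyE; simp add: pverts_simps parcs_simps)+
qed

lemma Delta122_simps:
  "pverts Delta122 = {1, 2, 3, 4, 5}"
  "parcs Delta122 = {(1,2), (1,3), (2,4), (2,5), (3,4), (3,5), (4,1), (5,1), (2,3), (4,5)}"
  unfolding Delta122_def by auto

text \<open>\<open>Delta122\<close> fixes the arcs inside the pairs. Since \<open>delta\<close> does
  not, each pair is exchanged where necessary, which gives four cases.\<close>

lemma delta_free_tour_of_tournament:
  assumes "tournament G" "free_of G Delta122"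
  shows "delta_free_tour (pverts G) (beats G)"
proof -
  interpret tournament G by fact
  have ordered: False
    if V: "{x, y1, y2, z1, z2} \<subseteq> pverts G"
      and arcs: "beats G x y1" "beats G x y2" "beats G y1 z1" "beats G y1 z2" "beats G y2 z1" "beats G y2 z2"
      "beats G z1 x" "beats G z2 x" "beats G y1 y2" "beats G z1 z2" for x y1 y2 z1 z2
  proof -
    have rev: "\<not> beats G b a" "a \<noteq> b" if "beats G a b" for a b
      using that one_direction[of a b] no_loops' in_arcsD1 in_arcsD2 by blast+
    note r = arcs arcs[THEN rev(1)] arcs[THEN rev(2)] arcs[THEN rev(2), THEN not_sym]
    let ?h = "(\<lambda>a. 1 :: int)(y1 := 2, y2 := 3, z1 := 4, z2 := 5)"
    have "contains_copy G Delta122"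
    proof (rule contains_copyI[where X = "{x, y1, y2, z1, z2}" and h = ?h])
      show "bij_betw ?h {x, y1, y2, z1, z2} (pverts Delta122)"
        unfolding bij_betw_def inj_on_def Delta122_simps using r by auto
      show "(a, b) \<in> parcs G \<longleftrightarrow> (?h a, ?h b) \<in> parcs Delta122"
        if "a \<in> {x, y1, y2, z1, z2}" "b \<in> {x, y1, y2, z1, z2}" for a b
        using that r no_loops' by (auto simp: Delta122_simps)
    qed (use assms V in \<open>auto simp: Delta122_simps\<close>)
    then show False using assms by blast
  qed
  show ?thesis
  proof
    show "finite (pverts G)" by (rule pair_finite_verts)
    show "\<not> beats G x x" for x using no_loops' by blast
    show "beats G x y \<longleftrightarrow> \<not> beats G y x" if "x \<in> pverts G" "y \<in> pverts G" "x \<noteq> y" for x y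
      using one_direction that by blast
    fix x y1 y2 z1 z2
    assume *: "x \<in> pverts G" "y1 \<in> pverts G" "y2 \<in> pverts G" "z1 \<in> pverts G" "z2 \<in> pverts G"
      "y1 \<noteq> y2" "z1 \<noteq> z2" "beats G x y1" "beats G x y2" "beats G y1 z1" "beats G y1 z2" "beats G y2 z1"
      "beats G y2 z2" "beats G z1 x" "beats G z2 x"
    have "beats G y1 y2 \<or> beats G y2 y1" "beats G z1 z2 \<or> beats G z2 z1"
      using one_direction[of y1 y2] one_direction[of z1 z2] * by blast+
    then show False
      using ordered[of x y1 y2 z1 z2] ordered[of x y2 y1 z1 z2] ordered[of x y1 y2 z2 z1]
        ordered[of x y2 y1 z2 z1] * by blast
  qed
qed

text \<open>Returns from positions to lists. Ties are allowed: the ordering for the bridge comes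
  from a rank with five values.\<close>

lemma sorted_vertex_ordering:
  fixes r :: "'a \<Rightarrow> int"
  assumes "finite (pverts G)"
  obtains \<sigma> where "vertex_ordering G \<sigma>"
    and "\<And>i j. \<lbrakk>i < j; j < length \<sigma>\<rbrakk> \<Longrightarrow> r (\<sigma> ! i) \<le> r (\<sigma> ! j)"
proof -
  obtain xs where xs: "set xs = pverts G" "distinct xs" using finite_distinct_list[OF assms] by blast
  show thesis
  proof
    show "vertex_ordering G (sort_key r xs)" using xs by (simp add: vertex_ordering_def)
    show "r (sort_key r xs ! i) \<le> r (sort_key r xs ! j)" if "i < j" "j < length (sort_key r xs)" for i j
      using sorted_nth_mono[OF sorted_sort_key[of r xs], of i j] that by simp
  qed
qed

lemma paving_of_paved:
  assumes "tournament G" "paved (pverts G) (beats G) pos"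
  shows "paving G"
proof -
  interpret tournament G by fact
  obtain \<sigma> where ord: "vertex_ordering G \<sigma>"
    and mono: "\<And>i j. \<lbrakk>i < j; j < length \<sigma>\<rbrakk> \<Longrightarrow> pos (\<sigma> ! i) \<le> pos (\<sigma> ! j)"
    using sorted_vertex_ordering[OF pair_finite_verts, of pos] by blast
  note inj = single_backD(1)[OF pavedD(1)[OF assms(2)]]
  note left = single_backD(2)[OF pavedD(1)[OF assms(2)]]
  note right = single_backD(3)[OF pavedD(1)[OF assms(2)]]
  have mem: "\<sigma> ! i \<in> pverts G" if "i < length \<sigma>" for i
    using ord nth_mem[OF that] by (simp add: vertex_ordering_def)
  have neq: "\<sigma> ! i = \<sigma> ! j \<longleftrightarrow> i = j" if "i < length \<sigma>" "j < length \<sigma>" for i j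
    using ord that by (simp add: vertex_ordering_def nth_eq_iff_index_eq)
  have less: "pos (\<sigma> ! i) < pos (\<sigma> ! j)" if "i < j" "j < length \<sigma>" for i j
    using mono[OF that] inj[of "\<sigma> ! i" "\<sigma> ! j"] mem neq that by force
  have edge: "(\<sigma> ! i, \<sigma> ! j) \<in> parcs (backedge_graph G \<sigma>) \<longleftrightarrow>
      (if i < j then beats G (\<sigma> ! j) (\<sigma> ! i) else j < i \<and> beats G (\<sigma> ! i) (\<sigma> ! j))"
    if "i < length \<sigma>" "j < length \<sigma>" for i j
  proof -
    have backedge: "(\<sigma> ! i, \<sigma> ! j) \<in> backedges G \<sigma> \<longleftrightarrow> j < i \<and> beats G (\<sigma> ! i) (\<sigma> ! j)"
      if "i < length \<sigma>" "j < length \<sigma>" for i j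
    proof
      assume "(\<sigma> ! i, \<sigma> ! j) \<in> backedges G \<sigma>"
      then obtain i' j' where *: "\<sigma> ! i = \<sigma> ! i'" "\<sigma> ! j = \<sigma> ! j'" "j' < i'" "i' < length \<sigma>"
        "beats G (\<sigma> ! i') (\<sigma> ! j')" unfolding backedges_def by blast
      then have "i = i'" "j = j'" using neq that by auto
      then show "j < i \<and> beats G (\<sigma> ! i) (\<sigma> ! j)" using * by simp
    qed (use that in \<open>auto simp: backedges_def\<close>)
    show ?thesis using backedge[OF that] backedge[OF that(2,1)] by (auto simp: backedge_graph_def)
  qed
  \<comment> \<open>An infinite \<open>A\<close> has cardinality 0 by convention, so the bound
    covers it too.\<close>
  have card1: "card A \<le> 1" if "\<And>s t. s \<in> A \<Longrightarrow> t \<in> A \<Longrightarrow> s = t" for A :: "nat set"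
    using that by (metis One_nat_def card.infinite card_le_Suc0_iff_eq zero_le)
  have "paving_ordering G \<sigma>"
    unfolding paving_ordering_def
  proof (intro conjI allI impI)
    show "vertex_ordering G \<sigma>" by (rule ord)
  next
    fix i assume i: "Suc i < length \<sigma>"
    show "(\<sigma> ! i, \<sigma> ! Suc i) \<notin> parcs (backedge_graph G \<sigma>)"
    proof
      assume "(\<sigma> ! i, \<sigma> ! Suc i) \<in> parcs (backedge_graph G \<sigma>)"
      then have "beats G (\<sigma> ! Suc i) (\<sigma> ! i)" using edge[of i "Suc i"] i by simp
      \<comment> \<open>The separating vertex would need an index strictly between two consecutive
        ones.\<close>
      then obtain m where m: "m \<in> pverts G" "pos (\<sigma> ! i) < pos m" "pos m < pos (\<sigma> ! Suc i)"
        using pavedD(2)[OF assms(2)] mem i less[of i "Suc i"] by (meson Suc_lessD lessI)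
      then have "m \<in> set \<sigma>" using ord by (simp add: vertex_ordering_def)
      then obtain k where "k < length \<sigma>" "m = \<sigma> ! k" by (metis in_set_conv_nth)
      then show False using m mono[of k i] mono[of "Suc i" k] i by (cases k "Suc i" rule: linorder_cases) (auto simp: less_Suc_eq)
    qed
  next
    fix i assume i: "i < length \<sigma>"
    show "card {s. s < i \<and> (\<sigma> ! i, \<sigma> ! s) \<in> parcs (backedge_graph G \<sigma>)} \<le> 1"
    proof (rule card1)
      fix s t assume "s \<in> {s. s < i \<and> (\<sigma> ! i, \<sigma> ! s) \<in> parcs (backedge_graph G \<sigma>)}"
        "t \<in> {s. s < i \<and> (\<sigma> ! i, \<sigma> ! s) \<in> parcs (backedge_graph G \<sigma>)}"
      then have "s < i" "t < i" "beats G (\<sigma> ! i) (\<sigma> ! s)" "beats G (\<sigma> ! i) (\<sigma> ! t)"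
        using edge[of i s] edge[of i t] i by auto
      then show "s = t"
        using left[of "\<sigma> ! s" "\<sigma> ! t" "\<sigma> ! i"] less[of s i] less[of t i] mem neq[of s t] i by auto
    qed
    show "card {t. i < t \<and> t < length \<sigma> \<and> (\<sigma> ! i, \<sigma> ! t) \<in> parcs (backedge_graph G \<sigma>)} \<le> 1"
    proof (rule card1)
      fix s t assume "s \<in> {t. i < t \<and> t < length \<sigma> \<and> (\<sigma> ! i, \<sigma> ! t) \<in> parcs (backedge_graph G \<sigma>)}"
        "t \<in> {t. i < t \<and> t < length \<sigma> \<and> (\<sigma> ! i, \<sigma> ! t) \<in> parcs (backedge_graph G \<sigma>)}"
      then have "i < s" "i < t" "s < length \<sigma>" "t < length \<sigma>"
        "beats G (\<sigma> ! s) (\<sigma> ! i)" "beats G (\<sigma> ! t) (\<sigma> ! i)"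
        using edge[of i s] edge[of i t] i by auto
      then show "s = t"
        using right[of "\<sigma> ! s" "\<sigma> ! t" "\<sigma> ! i"] less[of i s] less[of i t] mem neq[of s t] i by auto
    qed
  qed
  then show ?thesis unfolding paving_def by blast
qed

section \<open>Substitutions and joins\<close>

text \<open>The vertex map of both isomorphisms, onto \<open>substitute\<close> and onto
  \<open>P7_minus_join\<close>.\<close>

definition split_off :: "('b \<Rightarrow> 'a) \<Rightarrow> 'b set \<Rightarrow> 'a \<Rightarrow> 'a + 'b" where
  "split_off f A x = (if x \<in> f ` A then Inr (the_inv_into A f x) else Inl x)"

lemma split_off_simps:
  "inj_on f A \<Longrightarrow> i \<in> A \<Longrightarrow> split_off f A (f i) = Inr i"
  "x \<notin> f ` A \<Longrightarrow> split_off f A x = Inl x"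
  by (auto simp: split_off_def the_inv_into_f_f)

lemma bij_betw_split_off:
  assumes inj: "inj_on f A" and "f ` A \<subseteq> V"
  shows "bij_betw (split_off f A) V (Inl ` (V - f ` A) \<union> Inr ` A)"
proof (rule bij_betw_imageI)
  show "inj_on (split_off f A) V"
  proof (rule inj_onI)
    fix x y assume "x \<in> V" "y \<in> V" "split_off f A x = split_off f A y"
    then show "x = y"
      unfolding split_off_def by (metis Inl_inject Inr_Inl_False Inr_inject f_the_inv_into_f inj)
  qed
  have "V = (V - f ` A) \<union> f ` A" using assms(2) by blast
  moreover have "split_off f A ` (V - f ` A) = Inl ` (V - f ` A)"
    by (rule image_cong) (auto simp: split_off_simps)
  moreover have "split_off f A ` f ` A = Inr ` A"
    unfolding image_image by (rule image_cong) (auto simp: split_off_simps inj)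
  ultimately show "split_off f A ` V = Inl ` (V - f ` A) \<union> Inr ` A"
    by (metis image_Un)
qed

lemma substitute_simps:
  "pverts (substitute G v S) = Inl ` (pverts G - {v}) \<union> Inr ` pverts S"
  "(Inl x, Inl y) \<in> parcs (substitute G v S) \<longleftrightarrow>
    x \<in> pverts G - {v} \<and> y \<in> pverts G - {v} \<and> (x, y) \<in> parcs G"
  "(Inr i, Inr j) \<in> parcs (substitute G v S) \<longleftrightarrow> (i, j) \<in> parcs S"
  "(Inl x, Inr j) \<in> parcs (substitute G v S) \<longleftrightarrow>
    x \<in> pverts G - {v} \<and> j \<in> pverts S \<and> (x, v) \<in> parcs G"
  "(Inr i, Inl y) \<in> parcs (substitute G v S) \<longleftrightarrow>
    y \<in> pverts G - {v} \<and> i \<in> pverts S \<and> (y, v) \<notin> parcs G"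
  by (auto simp: substitute_def Let_def)

text \<open>All out-degrees in \<open>P7\<close> are 3, and 3, 5, 6 are the vertices that beat the
  deleted vertex 7. The classes are the squares and the non-squares modulo 7.\<close>

lemma degree_classes: "D1 = {1, 2, 4}" "D2 = {3, 5, 6}"
proof -
  have "out_arcs P7_minus 1 = {(1,2), (1,3), (1,5)}" "out_arcs P7_minus 2 = {(2,3), (2,4), (2,6)}"
    "out_arcs P7_minus 3 = {(3,4), (3,5)}" "out_arcs P7_minus 4 = {(4,5), (4,6), (4,1)}"
    "out_arcs P7_minus 5 = {(5,6), (5,2)}" "out_arcs P7_minus 6 = {(6,1), (6,3)}"
    unfolding out_arcs_def with_proj_simps parcs_simps by auto
  then show "D1 = {1, 2, 4}" "D2 = {3, 5, 6}"
    unfolding D1_def D2_def pverts_simps out_degree_def by auto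
qed

lemma P7_minus_join_simps:
  "pverts (P7_minus_join J u v) = Inl ` (pverts J - {u, v}) \<union> Inr ` pverts P7_minus"
  "(Inl x, Inl y) \<in> parcs (P7_minus_join J u v) \<longleftrightarrow>
    x \<in> pverts J - {u, v} \<and> y \<in> pverts J - {u, v} \<and> (x, y) \<in> parcs J"
  "(Inr i, Inr j) \<in> parcs (P7_minus_join J u v) \<longleftrightarrow> (i, j) \<in> parcs P7_minus"
  "(Inl x, Inr j) \<in> parcs (P7_minus_join J u v) \<longleftrightarrow>
    x \<in> pverts J - {u, v} \<and> (j \<in> D2 \<and> (x, u) \<in> parcs J \<or> j \<in> D1 \<and> (x, v) \<in> parcs J)"
  "(Inr i, Inl y) \<in> parcs (P7_minus_join J u v) \<longleftrightarrow>
    y \<in> pverts J - {u, v} \<and> (i \<in> D2 \<and> (u, y) \<in> parcs J \<or> i \<in> D1 \<and> (v, y) \<in> parcs J)"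
  unfolding P7_minus_join_def Let_def by auto

lemma matching_betweenI:
  assumes "X \<inter> Y = {}"
    and "\<And>x y y'. \<lbrakk>x \<in> X; y \<in> Y; y' \<in> Y; (x, y) \<in> parcs B; (x, y') \<in> parcs B\<rbrakk> \<Longrightarrow> y = y'"
    and "\<And>x x' y. \<lbrakk>x \<in> X; x' \<in> X; y \<in> Y; (x, y) \<in> parcs B; (x', y) \<in> parcs B\<rbrakk> \<Longrightarrow> x = x'"
  shows "matching_between B X Y"
  unfolding matching_between_def
proof (rule pairwiseI)
  fix e e' assume "e \<in> {{x, y} |x y. x \<in> X \<and> y \<in> Y \<and> (x, y) \<in> parcs B}"
    "e' \<in> {{x, y} |x y. x \<in> X \<and> y \<in> Y \<and> (x, y) \<in> parcs B}" "e \<noteq> e'"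
  then obtain x y x' y' where *: "e = {x, y}" "x \<in> X" "y \<in> Y" "(x, y) \<in> parcs B"
    "e' = {x', y'}" "x' \<in> X" "y' \<in> Y" "(x', y') \<in> parcs B" by blast
  then have "x \<noteq> x'" "y \<noteq> y'" using assms(2,3) \<open>e \<noteq> e'\<close> by blast+
  moreover have "x \<noteq> y'" "y \<noteq> x'" using * assms(1) by blast+
  ultimately show "disjnt e e'" using * by (simp add: disjnt_def)
qed

lemma ex_substitution:
  fixes G :: "'a pair_pre_digraph"
  assumes G: "tournament G" "free_of G Delta122" and S: "S \<in> {T5, P7, P7_minus}" "basic S"
    and emb: "embeds (pverts G) (beats G) S f"
    and hom: "\<And>w. \<lbrakk>w \<in> pverts G; w \<notin> f ` pverts S\<rbrakk> \<Longrightarrow>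
      (\<forall>i \<in> pverts S. beats G w (f i)) \<or> (\<forall>i \<in> pverts S. beats G (f i) w)"
  shows "\<exists>(J :: 'a pair_pre_digraph) v (S :: int pair_pre_digraph).
    tournament J \<and> free_of J Delta122 \<and> card (pverts J) < card (pverts G) \<and>
    nice_vertex J v \<and> basic S \<and> digraph_iso G (substitute J v S)"
proof -
  interpret tournament G by (rule G)
  interpret D: delta_free_tour "pverts G" "beats G" by (rule delta_free_tour_of_tournament[OF G])
  note total = patterns_total[OF S(1)]
  note inj = embeds_tournament(1)[OF G(1) emb total(1,2)]
  note arcs = embeds_tournament(2)[OF G(1) emb total(1,2)]
  define P where "P = f ` pverts S"
  \<comment> \<open>The vertex \<open>f 1\<close> represents the whole copy; if the copy is all of
    \<open>G\<close>, then \<open>J\<close> is a single vertex.\<close>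
  define J where "J = induced G ((pverts G - P) \<union> {f 1})"
  have one: "1 \<in> pverts S" "2 \<in> pverts S" using total(4) by auto
  have P: "P \<subseteq> pverts G" using emb unfolding embeds_def P_def by blast
  have f12: "f 1 \<in> P" "f 2 \<in> P" "f 1 \<noteq> f 2" "f 1 \<in> pverts G" "f 2 \<in> pverts G"
    using one inj_onD[OF inj, of 1 2] P unfolding P_def by auto
  have J: "pverts J = (pverts G - P) \<union> {f 1}"
    "\<And>a b. (a, b) \<in> parcs J \<longleftrightarrow> beats G a b \<and> a \<in> pverts J \<and> b \<in> pverts J"
    unfolding J_def by auto
  have subJ: "pverts J \<subseteq> pverts G" using J(1) f12 by auto
  have out: "beats G (f i) w \<longleftrightarrow> \<not> beats G w (f 1)" "beats G w (f i) \<longleftrightarrow> beats G w (f 1)"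
    if w: "w \<in> pverts G" "w \<notin> P" and i: "i \<in> pverts S" for w i
    using hom[of w] w i one D.asym[of w "f i"] D.asym[of w "f 1"] P unfolding P_def by blast+
  have "tournament J" "free_of J Delta122"
    using tournament_induced[OF G(1) subJ] free_of_induced[OF G(2) subJ] J(1) unfolding J_def by auto
  moreover have "card (pverts J) < card (pverts G)"
  proof (rule psubset_card_mono[OF pair_finite_verts])
    have "f 2 \<in> pverts G - pverts J" using J(1) f12 by auto
    then show "pverts J \<subset> pverts G" using subJ by blast
  qed
  moreover have "nice_vertex J (f 1)"
    unfolding nice_vertex_def
  proof (intro conjI notI)
    show "f 1 \<in> pverts J" using J(1) by simp
    assume "\<exists>x y1 y2. x \<noteq> y1 \<and> x \<noteq> y2 \<and> y1 \<noteq> y2 \<and>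
      cyclic_triangle J (f 1) x y1 \<and> cyclic_triangle J (f 1) x y2"
    then obtain x y1 y2 where *: "y1 \<noteq> y2" "cyclic_triangle J (f 1) x y1" "cyclic_triangle J (f 1) x y2"
      by blast
    have outside: "w \<in> pverts G" "w \<notin> P" if "beats J w (f 1) \<or> beats J (f 1) w" for w
      using that J no_loops'[of "f 1" "f 1"] by auto
    have xy: "x \<in> pverts G" "x \<notin> P" "y1 \<in> pverts G" "y1 \<notin> P" "y2 \<in> pverts G" "y2 \<notin> P"
      using * outside unfolding cyclic_triangle_def by blast+
    have "beats G (f 1) x \<and> beats G x y1 \<and> beats G x y2 \<and> beats G y1 (f 1) \<and> beats G y2 (f 1) \<or>
      beats G x (f 1) \<and> beats G (f 1) y1 \<and> beats G (f 1) y2 \<and> beats G y1 x \<and> beats G y2 x"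
      using * D.asym[of x "f 1"] xy f12 unfolding cyclic_triangle_def J(2) by blast
    \<comment> \<open>Outside the copy \<open>f 2\<close> has the same neighbours as
      \<open>f 1\<close>, so the two triangles extend to
      \<open>x -> {y1, y2} -> {f 1, f 2} -> x\<close> or
      \<open>x -> {f 1, f 2} -> {y1, y2} -> x\<close>.\<close>
    then show False
      using D.delta[of x y1 y2 "f 1" "f 2"] D.delta[of x "f 1" "f 2" y1 y2] xy * f12
        out(1)[OF xy(1,2) one(2)] out(1)[OF xy(3,4) one(2)] out(1)[OF xy(5,6) one(2)]
        out(1)[OF xy(1,2) one(1)] out(1)[OF xy(3,4) one(1)] out(1)[OF xy(5,6) one(1)]
        out(2)[OF xy(1,2) one(2)] out(2)[OF xy(3,4) one(2)] out(2)[OF xy(5,6) one(2)]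
      by blast
  qed
  moreover have "digraph_iso G (substitute J (f 1) S)"
  proof (rule digraph_isoI[OF G(1), of "split_off f (pverts S)"])
    have W: "pverts J - {f 1} = pverts G - P" using J(1) f12 by auto
    note simps = split_off_simps[where f = f and A = "pverts S", folded P_def] inj substitute_simps W
    show "bij_betw (split_off f (pverts S)) (pverts G) (pverts (substitute J (f 1) S))"
      using bij_betw_split_off[OF inj, of "pverts G"] P unfolding substitute_simps W P_def by blast
    show "parcs (substitute J (f 1) S) \<subseteq> pverts (substitute J (f 1) S) \<times> pverts (substitute J (f 1) S)"
      using total(3) unfolding substitute_def Let_def by auto
    fix a b assume ab: "a \<in> pverts G" "b \<in> pverts G"
    consider (1) i j where "a = f i" "i \<in> pverts S" "b = f j" "j \<in> pverts S"
      | (2) i where "a = f i" "i \<in> pverts S" "b \<notin> P"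
      | (3) j where "a \<notin> P" "b = f j" "j \<in> pverts S"
      | (4) "a \<notin> P" "b \<notin> P" unfolding P_def by blast
    then show "(a, b) \<in> parcs G \<longleftrightarrow>
      (split_off f (pverts S) a, split_off f (pverts S) b) \<in> parcs (substitute J (f 1) S)"
    proof cases
      case 1
      then show ?thesis using arcs by (simp add: simps)
    next
      case 2
      then show ?thesis using ab out(1)[of b i] f12 by (auto simp: simps J)
    next
      case 3
      then show ?thesis using ab out(2)[of a j] f12 by (auto simp: simps J)
    next
      case 4
      then show ?thesis using ab f12 by (auto simp: simps J)
    qed
  qed
  ultimately show ?thesis using S(2) by blast
qed

text \<open>A vertex that beats the image of \<open>D1\<close> and loses to that of
  \<open>D2\<close> would complete the copy to \<open>P7\<close>. For the other kinds of outside
  vertices, one vertex of each degree class determines all arcs to the copy.\<close>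

lemma ex_join:
  fixes G :: "'a pair_pre_digraph"
  assumes G: "tournament G" "free_of G Delta122"
    and emb: "embeds (pverts G) (beats G) P7_minus f"
    and no_P7: "\<nexists>f. embeds (pverts G) (beats G) P7 f"
  shows "\<exists>(J :: 'a pair_pre_digraph) u v.
    tournament J \<and> free_of J Delta122 \<and> card (pverts J) < card (pverts G) \<and>
    bridge J u v \<and> digraph_iso G (P7_minus_join J u v)"
proof -
  interpret tournament G by (rule G)
  interpret D: delta_free_tour "pverts G" "beats G" by (rule delta_free_tour_of_tournament[OF G])
  have S: "P7_minus \<in> {T5, P7, P7_minus}" by simp
  note total = patterns_total[OF S]
  note inj = embeds_tournament(1)[OF G(1) emb total(1,2)]
  note arcs = embeds_tournament(2)[OF G(1) emb total(1,2)]
  define P where "P = f ` pverts P7_minus"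
  \<comment> \<open>Representatives of \<open>D2\<close> and \<open>D1\<close>, chosen so that
    \<open>(3, 4)\<close> is an arc of \<open>P7_minus\<close>.\<close>
  define u where "u = f 3"
  define v where "v = f 4"
  define J where "J = induced G ((pverts G - P) \<union> {u, v})"
  have P: "P \<subseteq> pverts G" using emb unfolding embeds_def P_def by blast
  have fV: "f i \<in> pverts G" "f i \<in> P" if "i \<in> {1, 2, 3, 4, 5, 6}" for i
    using that P unfolding P_def pverts_simps by blast+
  have fneq: "f i \<noteq> f j" if "i \<in> {1, 2, 3, 4, 5, 6}" "j \<in> {1, 2, 3, 4, 5, 6}" "i \<noteq> j" for i j
    using inj that unfolding pverts_simps by (auto dest: inj_onD)
  have uv: "beats G u v" "u \<noteq> v" "u \<in> pverts G" "v \<in> pverts G" "u \<in> P" "v \<in> P"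
    using arcs[of 3 4] fneq[of 3 4] fV[of 3] fV[of 4] unfolding u_def v_def pverts_simps parcs_simps by auto
  have J: "pverts J = (pverts G - P) \<union> {u, v}"
    "\<And>a b. (a, b) \<in> parcs J \<longleftrightarrow> beats G a b \<and> a \<in> pverts J \<and> b \<in> pverts J"
    unfolding J_def by auto
  have subJ: "pverts J \<subseteq> pverts G" using J(1) uv by auto
  have tJ: "tournament J" "free_of J Delta122"
    using tournament_induced[OF G(1) subJ] free_of_induced[OF G(2) subJ] J(1) unfolding J_def by auto
  let ?above = "\<lambda>w. \<forall>i \<in> {1, 2, 3, 4, 5, 6}. beats G w (f i)"
  let ?below = "\<lambda>w. \<forall>i \<in> {1, 2, 3, 4, 5, 6}. beats G (f i) w"
  let ?between = "\<lambda>w. (\<forall>i \<in> {1, 2, 4}. beats G (f i) w) \<and> (\<forall>i \<in> {3, 5, 6}. beats G w (f i))"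
  have kinds: "?above w \<or> ?below w \<or> ?between w" if w: "w \<in> pverts G" "w \<notin> P" for w
  proof (rule ccontr)
    assume "\<not> ?thesis"
    then have "(\<forall>i \<in> {1, 2, 4}. beats G w (f i)) \<and> (\<forall>i \<in> {3, 5, 6}. beats G (f i) w)"
      using D.P7_minus_attachments[OF emb w(1)] w(2) unfolding P_def pverts_simps by blast
    then have "embeds (pverts G) (beats G) P7 (f(7 := w))"
      using emb w unfolding embeds_def pverts_simps parcs_simps by simp
    then show False using no_P7 by blast
  qed
  \<comment> \<open>Sorting by \<open>r\<close> gives the order: above, \<open>v\<close>, between, \<open>u\<close>, below; ties are irrelevant.\<close>
  define r :: "'a \<Rightarrow> int" where
    "r x = (if x = v then 1 else if x = u then 3 else if ?above x then 0 else if ?below x then 4 else 2)" for x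
  have r_uv: "r v = 1" "r u = 3" using uv(2) by (auto simp: r_def)
  have r: "r w = 0 \<and> ?above w \<or> r w = 2 \<and> ?between w \<or> r w = 4 \<and> ?below w"
    if w: "w \<in> pverts G" "w \<notin> P" for w
    using kinds[OF w] w uv(5,6) by (auto simp: r_def)
  have r_out: "r w \<in> {0, 2, 4}" if "w \<in> pverts G" "w \<notin> P" for w using r[OF that] by auto
  have above: "beats G w (f i)" if "w \<in> pverts G" "w \<notin> P" "r w = 0" "i \<in> {1, 2, 3, 4, 5, 6}" for w i
    using r[OF that(1,2)] that by auto
  have below: "beats G (f i) w" if "w \<in> pverts G" "w \<notin> P" "r w = 4" "i \<in> {1, 2, 3, 4, 5, 6}" for w i
    using r[OF that(1,2)] that by auto
  have between: "i \<in> {1, 2, 4} \<Longrightarrow> beats G (f i) w" "i \<in> {3, 5, 6} \<Longrightarrow> beats G w (f i)"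
    if "w \<in> pverts G" "w \<notin> P" "r w = 2" for w i
    using r[OF that(1,2)] that by auto
  have "card (pverts J) < card (pverts G)"
  proof (rule psubset_card_mono[OF pair_finite_verts])
    have "f 1 \<in> pverts G - pverts J"
      using J(1) fV[of 1] fneq[of 1 3] fneq[of 1 4] unfolding u_def v_def by auto
    then show "pverts J \<subset> pverts G" using subJ by blast
  qed
  moreover have "bridge J u v"
  proof -
    interpret J: tournament J by (rule tJ)
    obtain \<sigma> where \<sigma>: "vertex_ordering J \<sigma>"
      and mono: "\<And>i j. \<lbrakk>i < j; j < length \<sigma>\<rbrakk> \<Longrightarrow> r (\<sigma> ! i) \<le> r (\<sigma> ! j)"
      using sorted_vertex_ordering[OF J.pair_finite_verts, of r] by blast
    have dist: "distinct \<sigma>" and set: "set \<sigma> = pverts J" using \<sigma> by (auto simp: vertex_ordering_def)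
    have "u \<in> set \<sigma>" "v \<in> set \<sigma>" using set J(1) by auto
    then obtain i j where i: "i < length \<sigma>" "u = \<sigma> ! i" and j: "j < length \<sigma>" "v = \<sigma> ! j"
      by (metis in_set_conv_nth)
    have "j < i"
    proof (rule ccontr)
      assume "\<not> j < i"
      then have "i < j" using i j uv(2) by (cases "i = j") auto
      then show False using mono[of i j] i j r_uv by simp
    qed
    let ?B = "backedge_graph J \<sigma>"
    have backedge: "beats G a b" "r b \<le> r a" "a \<in> pverts J" "b \<in> pverts J" if "(a, b) \<in> backedges J \<sigma>" for a b
      using that mono J.in_arcsD1 J.in_arcsD2 unfolding backedges_def J(2) by blast+
    have JD: "w = u \<or> w = v \<or> w \<in> pverts G \<and> w \<notin> P" if "w \<in> pverts J" for w
      using that J(1) by blast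
    have uv_back: "(u, v) \<in> backedges J \<sigma>"
      using i j \<open>j < i\<close> uv(1) J(1) unfolding backedges_def J(2) by auto
    have asym: "\<not> beats G b a" if "beats G a b" for a b
      using that D.asym in_arcsD1 in_arcsD2 by blast
    \<comment> \<open>Ranks 0 and 2 beat \<open>u\<close>, which beats rank 4; rank 0 beats
      \<open>v\<close>, which beats ranks 2 and 4. Hence the arc from \<open>u\<close> to
      \<open>v\<close> is the only back edge at either end.\<close>
    have from_u: "x = v" if "(u, x) \<in> backedges J \<sigma>" for x
      using backedge[OF that] JD[of x] r_uv r_out[of x] above[of x 3] between(2)[of x 3] asym[of u x] no_loops'[of u u]
      unfolding u_def[symmetric] by auto
    have to_u: "(x, u) \<notin> backedges J \<sigma>" for x
      using backedge[of x u] JD[of x] r_uv r_out[of x] below[of x 3] asym[of u x] no_loops'[of u u]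
      unfolding u_def[symmetric] by auto
    have to_v: "x = u" if "(x, v) \<in> backedges J \<sigma>" for x
      using backedge[OF that] JD[of x] r_uv r_out[of x] below[of x 4] between(1)[of x 4] asym[of x v] no_loops'[of v v]
      unfolding v_def[symmetric] by auto
    have from_v: "(v, x) \<notin> backedges J \<sigma>" for x
      using backedge[of v x] JD[of x] r_uv r_out[of x] above[of x 4] asym[of x v] no_loops'[of v v]
      unfolding v_def[symmetric] by auto
    have "(u, x) \<in> parcs ?B \<longleftrightarrow> x = v" "(v, x) \<in> parcs ?B \<longleftrightarrow> x = u" for x
      using uv_back from_u[of x] to_u[of x] to_v[of x] from_v[of x]
      unfolding backedge_graph_def pair_pre_digraph.select_convs by blast+
    then have "out_arcs ?B u = {(u, v)}" "out_arcs ?B v = {(v, u)}"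
      unfolding out_arcs_def with_proj_simps by force+
    then have deg: "out_degree ?B u = 1" "out_degree ?B v = 1"
      unfolding out_degree_def by auto
    have take: "x \<in> pverts J" "r x \<le> r (\<sigma> ! k)" "x \<noteq> \<sigma> ! k"
      if "x \<in> set (take k \<sigma>)" "k < length \<sigma>" for x k
    proof -
      obtain l where l: "l < k" "x = \<sigma> ! l" using \<open>x \<in> set (take k \<sigma>)\<close> by (auto simp: in_set_conv_nth)
      then show "x \<in> pverts J" "r x \<le> r (\<sigma> ! k)" "x \<noteq> \<sigma> ! k"
        using that mono[of l k] nth_eq_iff_index_eq[OF dist, of l k] set nth_mem[of l \<sigma>] by auto
    qed
    have drop: "x \<in> pverts J" "r (\<sigma> ! k) \<le> r x" "x \<noteq> \<sigma> ! k"
      if "x \<in> set (drop (Suc k) \<sigma>)" "k < length \<sigma>" for x k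
    proof -
      obtain l where "l < length \<sigma> - Suc k" "x = \<sigma> ! (Suc k + l)"
        using \<open>x \<in> set (drop (Suc k) \<sigma>)\<close> by (auto simp: in_set_conv_nth)
      then obtain m where m: "k < m" "m < length \<sigma>" "x = \<sigma> ! m" by (metis less_add_Suc1 less_diff_conv add.commute add_Suc)
      then show "x \<in> pverts J" "r (\<sigma> ! k) \<le> r x" "x \<noteq> \<sigma> ! k"
        using that mono[of k m] nth_eq_iff_index_eq[OF dist, of k m] set nth_mem[of m \<sigma>] by auto
    qed
    have edge: "beats G y x" if "(x, y) \<in> parcs ?B" "r x < r y" for x y
      using that backedge[of x y] backedge[of y x] by (auto simp: backedge_graph_def)
    have "matching_between ?B (set (take i \<sigma>)) (set (drop (Suc i) \<sigma>))"
    proof -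
      have right: "y \<in> pverts G \<and> y \<notin> P \<and> r y = 4" if "y \<in> set (drop (Suc i) \<sigma>)" for y
        using drop[OF that i(1)] JD[of y] r_out[of y] r_uv i(2) by auto
      have left: "x \<in> pverts G \<and> x \<notin> P \<and> r x \<in> {0, 2} \<or> x = v" if "x \<in> set (take i \<sigma>)" for x
        using take[OF that i(1)] JD[of x] r_out[of x] r_uv i(2) by auto
      \<comment> \<open>The left end of such an edge beats \<open>f 3\<close> and
        \<open>f 5\<close>, and these beat all of rank 4. Two edges with a common end would give
        \<open>x -> {f 3, f 5} -> {y, y'} -> x\<close> or
        \<open>y -> {x, x'} -> {f 3, f 5} -> y\<close>.\<close>
      have edges: "beats G y x \<and> x \<in> pverts G \<and> x \<notin> P \<and> beats G x (f 3) \<and> beats G x (f 5)"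
        if xy: "x \<in> set (take i \<sigma>)" "y \<in> set (drop (Suc i) \<sigma>)" "(x, y) \<in> parcs ?B" for x y
      proof -
        have "r x < r y" using left[OF xy(1)] right[OF xy(2)] r_uv by auto
        then have "beats G y x" using edge xy(3) by blast
        moreover from this have "x \<noteq> v" using below[of y 4] right[OF xy(2)] asym[of y v] v_def by auto
        ultimately show ?thesis
          using left[OF xy(1)] above[of x 3] above[of x 5] between(2)[of x 3] between(2)[of x 5] by auto
      qed
      show ?thesis
      proof (rule matching_betweenI)
        show "set (take i \<sigma>) \<inter> set (drop (Suc i) \<sigma>) = {}"
          using left right r_uv by fastforce
      next
        fix x y y' assume *: "x \<in> set (take i \<sigma>)" "y \<in> set (drop (Suc i) \<sigma>)" "y' \<in> set (drop (Suc i) \<sigma>)"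
          "(x, y) \<in> parcs ?B" "(x, y') \<in> parcs ?B"
        show "y = y'"
          using D.delta[of x "f 3" "f 5" y y'] edges[OF *(1,2,4)] edges[OF *(1,3,5)] right[OF *(2)] right[OF *(3)]
            below[of y 3] below[of y 5] below[of y' 3] below[of y' 5] fneq[of 3 5] fV[of 3] fV[of 5] by auto
      next
        fix x x' y assume *: "x \<in> set (take i \<sigma>)" "x' \<in> set (take i \<sigma>)" "y \<in> set (drop (Suc i) \<sigma>)"
          "(x, y) \<in> parcs ?B" "(x', y) \<in> parcs ?B"
        show "x = x'"
          using D.delta[of y x x' "f 3" "f 5"] edges[OF *(1,3,4)] edges[OF *(2,3,5)] right[OF *(3)]
            below[of y 3] below[of y 5] fneq[of 3 5] fV[of 3] fV[of 5] by auto
      qed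
    qed
    moreover have "matching_between ?B (set (take j \<sigma>)) (set (drop (Suc j) \<sigma>))"
    proof -
      have left: "x \<in> pverts G \<and> x \<notin> P \<and> r x = 0" if "x \<in> set (take j \<sigma>)" for x
        using take[OF that j(1)] JD[of x] r_out[of x] r_uv j(2) by auto
      have right: "y \<in> pverts G \<and> y \<notin> P \<and> r y \<in> {2, 4} \<or> y = u" if "y \<in> set (drop (Suc j) \<sigma>)" for y
        using drop[OF that j(1)] JD[of y] r_out[of y] r_uv j(2) by auto
      \<comment> \<open>The same argument with \<open>f 1\<close> and \<open>f 2\<close> from
        \<open>D1\<close>: rank 0 beats them, and they beat the right end of each such edge.\<close>
      have edges: "beats G y x \<and> y \<in> pverts G \<and> y \<notin> P \<and> beats G (f 1) y \<and> beats G (f 2) y"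
        if xy: "x \<in> set (take j \<sigma>)" "y \<in> set (drop (Suc j) \<sigma>)" "(x, y) \<in> parcs ?B" for x y
      proof -
        have "r x < r y" using left[OF xy(1)] right[OF xy(2)] r_uv by auto
        then have "beats G y x" using edge xy(3) by blast
        moreover from this have "y \<noteq> u" using above[of x 3] left[OF xy(1)] asym[of u x] u_def by auto
        ultimately show ?thesis
          using right[OF xy(2)] below[of y 1] below[of y 2] between(1)[of y 1] between(1)[of y 2] by auto
      qed
      show ?thesis
      proof (rule matching_betweenI)
        show "set (take j \<sigma>) \<inter> set (drop (Suc j) \<sigma>) = {}"
          using left right r_uv by fastforce
      next
        fix x y y' assume *: "x \<in> set (take j \<sigma>)" "y \<in> set (drop (Suc j) \<sigma>)" "y' \<in> set (drop (Suc j) \<sigma>)"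
          "(x, y) \<in> parcs ?B" "(x, y') \<in> parcs ?B"
        show "y = y'"
          using D.delta[of x "f 1" "f 2" y y'] edges[OF *(1,2,4)] edges[OF *(1,3,5)] left[OF *(1)]
            above[of x 1] above[of x 2] fneq[of 1 2] fV[of 1] fV[of 2] by auto
      next
        fix x x' y assume *: "x \<in> set (take j \<sigma>)" "x' \<in> set (take j \<sigma>)" "y \<in> set (drop (Suc j) \<sigma>)"
          "(x, y) \<in> parcs ?B" "(x', y) \<in> parcs ?B"
        show "x = x'"
          using D.delta[of y x x' "f 1" "f 2"] edges[OF *(1,3,4)] edges[OF *(2,3,5)] left[OF *(1)] left[OF *(2)]
            above[of x 1] above[of x 2] above[of x' 1] above[of x' 2] fneq[of 1 2] fV[of 1] fV[of 2] by auto
      qed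
    qed
    ultimately show ?thesis
      unfolding bridge_def using \<sigma> i j \<open>j < i\<close> deg uv(1) J by blast
  qed
  moreover have "digraph_iso G (P7_minus_join J u v)"
  proof (rule digraph_isoI[OF G(1), of "split_off f (pverts P7_minus)"])
    have W: "pverts J - {u, v} = pverts G - P" using J(1) uv by auto
    have D: "pverts P7_minus = D1 \<union> D2" unfolding pverts_simps degree_classes by auto
    note simps = split_off_simps[where f = f and A = "pverts P7_minus", folded P_def] inj P7_minus_join_simps W
    have mem: "u \<in> pverts J" "v \<in> pverts J" using J(1) by auto
    \<comment> \<open>All three kinds are constant on each degree class, so \<open>u\<close> speaks
      for \<open>D2\<close> and \<open>v\<close> for \<open>D1\<close>.\<close>
    have out: "beats G w (f i) \<longleftrightarrow> (i \<in> D2 \<and> beats G w u \<or> i \<in> D1 \<and> beats G w v)"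
      "beats G (f i) w \<longleftrightarrow> (i \<in> D2 \<and> beats G u w \<or> i \<in> D1 \<and> beats G v w)"
      if w: "w \<in> pverts G" "w \<notin> P" and i: "i \<in> pverts P7_minus" for w i
    proof -
      have asym: "\<not> beats G b a" if "beats G a b" for a b
        using that D.asym in_arcsD1 in_arcsD2 by blast
      have "i \<in> {1, 2, 3, 4, 5, 6}" using i pverts_simps by simp
      then show "beats G w (f i) \<longleftrightarrow> (i \<in> D2 \<and> beats G w u \<or> i \<in> D1 \<and> beats G w v)"
        "beats G (f i) w \<longleftrightarrow> (i \<in> D2 \<and> beats G u w \<or> i \<in> D1 \<and> beats G v w)"
        using r[OF w] asym unfolding u_def v_def degree_classes by auto
    qed
    show "bij_betw (split_off f (pverts P7_minus)) (pverts G) (pverts (P7_minus_join J u v))"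
      using bij_betw_split_off[OF inj, of "pverts G"] P unfolding P7_minus_join_simps W P_def by blast
    show "parcs (P7_minus_join J u v) \<subseteq> pverts (P7_minus_join J u v) \<times> pverts (P7_minus_join J u v)"
      using total(3) D unfolding P7_minus_join_def Let_def by auto
    fix a b assume ab: "a \<in> pverts G" "b \<in> pverts G"
    consider (1) i j where "a = f i" "i \<in> pverts P7_minus" "b = f j" "j \<in> pverts P7_minus"
      | (2) i where "a = f i" "i \<in> pverts P7_minus" "b \<notin> P"
      | (3) j where "a \<notin> P" "b = f j" "j \<in> pverts P7_minus"
      | (4) "a \<notin> P" "b \<notin> P" unfolding P_def by blast
    then show "(a, b) \<in> parcs G \<longleftrightarrow>
      (split_off f (pverts P7_minus) a, split_off f (pverts P7_minus) b) \<in> parcs (P7_minus_join J u v)"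
    proof cases
      case 1
      then show ?thesis using arcs by (simp add: simps)
    next
      case 2
      then have "b \<in> pverts J" using ab J(1) by blast
      then show ?thesis using 2 ab out(2)[of b i] mem uv by (auto simp: simps J(2))
    next
      case 3
      then have "a \<in> pverts J" using ab J(1) by blast
      then show ?thesis using 3 ab out(1)[of a j] mem uv by (auto simp: simps J(2))
    next
      case 4
      then have "a \<in> pverts J" "b \<in> pverts J" using ab J(1) by blast+
      then show ?thesis using 4 ab uv by (auto simp: simps J(2))
    qed
  qed
  ultimately show ?thesis using tJ by blast
qed

section \<open>Case distinction by the patterns that occur\<close>

theorem theorem2p1:
  fixes T :: "'a pair_pre_digraph"
  assumes "tournament T" and "free_of T Delta122"
  shows "basic T
    \<or> (free_of T Delta122 \<and> paving T)
    \<or> (\<exists>(J :: 'a pair_pre_digraph) v (S :: int pair_pre_digraph).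
          tournament J \<and> free_of J Delta122 \<and> card (pverts J) < card (pverts T) \<and>
          nice_vertex J v \<and> basic S \<and> digraph_iso T (substitute J v S))
    \<or> (\<exists>(J :: 'a pair_pre_digraph) u v.
          tournament J \<and> free_of J Delta122 \<and> card (pverts J) < card (pverts T) \<and>
          bridge J u v \<and> digraph_iso T (P7_minus_join J u v))"
proof -
  interpret D: delta_free_tour "pverts T" "beats T" by (rule delta_free_tour_of_tournament[OF assms])
  have refl: "digraph_iso T5 T5" "digraph_iso P7 P7"
    using digraph_iso_refl patterns_total(3) by blast+
  \<comment> \<open>A copy of \<open>P7\<close> is treated before \<open>P7_minus\<close>, since
    \<open>ex_join\<close> needs \<open>P7\<close> to be absent. \<open>T5\<close> and
    \<open>P7\<close> lead to a substitution, \<open>P7_minus\<close> without \<open>P7\<close> to a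
    join, and the last case to a paving ordering.\<close>
  consider f where "embeds (pverts T) (beats T) T5 f"
    | f where "embeds (pverts T) (beats T) P7 f"
    | f where "embeds (pverts T) (beats T) P7_minus f" "\<nexists>f. embeds (pverts T) (beats T) P7 f"
    | "\<nexists>f. embeds (pverts T) (beats T) T5 f" "\<nexists>f. embeds (pverts T) (beats T) P7_minus f"
    by blast
  then show ?thesis
  proof cases
    case (1 f)
    then show ?thesis
      using ex_substitution[OF assms, of T5 f] D.T5_homogeneous[OF 1] refl unfolding basic_def by blast
  next
    case (2 f)
    then show ?thesis
      using ex_substitution[OF assms, of P7 f] D.P7_homogeneous[OF 2] refl unfolding basic_def by blast
  next
    case (3 f)
    then show ?thesis using ex_join[OF assms] by blast
  next
    case 4
    then show ?thesis
      using ex_paved[OF D.delta_free_tour_axioms] paving_of_paved[OF assms(1)] assms(2) by blast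
  qed
qed

end
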